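(* Let $G$ be an $\ell$-group, $X$ an almost transitive $G$-complex, $\mathcal{C}=\mathcal{C}(G,X)$, and $F:\mathcal{C}\to\mathtt{pHil}$ a semi-elementary functor; write $A=A(\mathcal{C},F)$. Then: (i) the map $\{a_Y\}_{Y\in\mathcal{C}}\mapsto a_X$ is an isomorphism of $*$-algebras from $A$ onto $\mathrm{End}_G(FX)$, the algebra of $G$-equivariant linear endomorphisms of the pre-Hilbert space $FX$ with involution given by taking the adjoint with respect to the inner product of $FX$ (here $G=\mathrm{End}_{\mathcal{C}}(X)$ acts on $FX$ via $F$); (ii) for every $a\in A$ there is $M=M(a)\ge0$ such that $\|a_Y\|\le M$ for all $Y\in\mathcal{C}$; in particular $\mathrm{Spec}_A(Y)$ is defined for every $Y\in\mathcal{C}$.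
   Context: A simplicial complex is a nonempty set of finite sets closed under subsets, assumed connected and locally finite; cover maps are vertex maps sending $i$-cells to $i$-cells, surjective on vertices and bijective on the sets of cells containing each vertex. An $\ell$-group is a locally compact totally disconnected Hausdorff group. A $G$-complex is a simplicial complex with a faithful $G$-action by automorphisms such that stabilizers of nonempty cells are compact open; it is almost transitive if $G\backslash X$ is finite. For $\Gamma\le G$, write $\Gamma\le_X G$ if the poset $\Gamma\backslash X$ (with $\Gamma x\le\Gamma y$ iff $\gamma x\subseteq y$ for some $\gamma\in\Gamma$) is a simplicial complex and $x\mapsto\Gamma x$ is a cover map. The category $\mathcal{C}(G,X)$ has objects $\Gamma\backslash X$ for $\Gamma\le_X G$ (with $1\backslash X=X$); $\mathrm{Hom}(X,\Gamma\backslash X)=\{p_\Gamma\circ g: g\in G\}$ where $p_\Gamma(x)=\Gamma x$; for $1\ne\Gamma'\le\Gamma\le_XG$, $\mathrm{Hom}(\Gamma'\backslash X,\Gamma\backslash X)=\{p_{\Gamma',\Gamma}\}$ with $p_{\Gamma',\Gamma}(\Gamma'x)=\Gamma x$; all other Hom-sets are empty (so $\mathrm{End}(X)=G$). $\mathtt{pHil}$ is the category of complex pre-Hilbert spaces with (not necessarily continuous) linear maps. For a set $Y$, $\tilde\ell^2(Y)$ is the pre-Hilbert space of finitely supported functions $Y\to\mathbb{C}$ with $\langle\varphi,\psi\rangle=\sum_y\varphi(y)\overline{\psi(y)}$; a map $f:Y\to Z$ induces $f_*$, $(f_*\varphi)(z)=\sum_{y\in f^{-1}(z)}\varphi(y)$.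 A functor $F:\mathcal{C}\to\mathtt{pHil}$ is elementary if there is a functor $S:\mathcal{C}\to\mathtt{Set}$ with: (E1) a unitary natural isomorphism $\tilde\ell^2\circ S\cong F$; (E2) for every $x\in SX$, $\mathrm{Stab}_G(x)$ is compact open and contained in the stabilizer of a nonempty cell of $X$; (E3) for all $\Gamma\le_XG$, the map $\Gamma\backslash SX\to S(\Gamma\backslash X)$, $\Gamma x\mapsto (Sp_\Gamma)(x)$, is a bijection; (E4) $G\backslash SX$ is finite. $F$ is semi-elementary if $F\oplus F'$ is elementary for some functor $F'$. A $(\mathcal{C},F)$-operator is a natural transformation $a=\{a_Y\}:F\to F$ for which there is a natural transformation $a^*=\{a^*_Y\}:F\to F$ with $a^*_Y$ the adjoint of $a_Y$ on $FY$ for all $Y$; the set $A(\mathcal{C},F)$ of these is a $*$-algebra. For an algebra $A$ of such operators acting by bounded operators on $FY$, $\mathrm{Spec}_A(Y)$ is the $A$-spectrum (set of irreducible unitary $A$-representations weakly contained) of the completion of the span of $\{a_Yv: a\in A, v\in FY\}$. *)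

theory Defs
  imports "HOL-Analysis.Analysis" "HOL-Algebra.Group"
begin

section \<open>Simplicial complexes and cover maps\<close>

text \<open>A simplicial complex is a nonempty set of finite sets closed under subsets,
  connected and locally finite.\<close>

definition verts :: "'a set set \<Rightarrow> 'a set" where
  "verts K = {v. {v} \<in> K}"

definition sc_connected :: "'a set set \<Rightarrow> bool" where
  "sc_connected K \<longleftrightarrow>
     (\<forall>u \<in> verts K. \<forall>w \<in> verts K. (u, w) \<in> {(a, b). {a, b} \<in> K}\<^sup>*)"

definition simplicial_complex :: "'a set set \<Rightarrow> bool" where
  "simplicial_complex K \<longleftrightarrow>
     K \<noteq> {} \<and> (\<forall>x \<in> K. finite x) \<and> (\<forall>x \<in> K. \<forall>y. y \<subseteq> x \<longrightarrow> y \<in> K) \<and>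
     sc_connected K \<and> (\<forall>v. finite {x \<in> K. v \<in> x})"

text \<open>Cover maps: vertex maps sending i-cells to i-cells, surjective on vertices and
  bijective on the sets of cells containing each vertex.\<close>

definition cover_map :: "'a set set \<Rightarrow> 'b set set \<Rightarrow> ('a \<Rightarrow> 'b) \<Rightarrow> bool" where
  "cover_map K L f \<longleftrightarrow>
     (\<forall>x \<in> K. f ` x \<in> L \<and> card (f ` x) = card x) \<and>
     f ` verts K = verts L \<and>
     (\<forall>v \<in> verts K. bij_betw (\<lambda>x. f ` x) {x \<in> K. v \<in> x} {y \<in> L. f v \<in> y})"

section \<open>l-groups and G-complexes\<close>

definition totally_disconnected_space :: "'a topology \<Rightarrow> bool" where
  "totally_disconnected_space T \<longleftrightarrow>
     (\<forall>S. S \<subseteq> topspace T \<and> connectedin T S \<longrightarrow> (\<exists>a. S \<subseteq> {a}))"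

text \<open>An l-group: a locally compact totally disconnected Hausdorff topological group.\<close>

definition l_group :: "('g, 'm) monoid_scheme \<Rightarrow> 'g topology \<Rightarrow> bool" where
  "l_group G T \<longleftrightarrow>
     group G \<and> topspace T = carrier G \<and>
     continuous_map (prod_topology T T) T (\<lambda>(g, h). g \<otimes>\<^bsub>G\<^esub> h) \<and>
     continuous_map T T (\<lambda>g. inv\<^bsub>G\<^esub> g) \<and>
     Hausdorff_space T \<and> locally_compact_space T \<and> totally_disconnected_space T"

text \<open>The action on vertices induces an action on cells by images.\<close>

definition cell_act :: "('g \<Rightarrow> 'v \<Rightarrow> 'v) \<Rightarrow> 'g \<Rightarrow> 'v set \<Rightarrow> 'v set" where
  "cell_act act g x = act g ` x"

definition cell_stab ::
  "('g, 'm) monoid_scheme \<Rightarrow> ('g \<Rightarrow> 'v \<Rightarrow> 'v) \<Rightarrow> 'v set \<Rightarrow> 'g set" where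
  "cell_stab G act x = {g \<in> carrier G. cell_act act g x = x}"

definition automorphism :: "'v set set \<Rightarrow> ('v \<Rightarrow> 'v) \<Rightarrow> bool" where
  "automorphism X f \<longleftrightarrow> bij_betw f (verts X) (verts X) \<and>
     (\<forall>x \<subseteq> verts X. f ` x \<in> X \<longleftrightarrow> x \<in> X)"

text \<open>A G-complex: a simplicial complex with a faithful action of G by automorphisms
  such that stabilizers of nonempty cells are compact open.\<close>

definition G_complex ::
  "('g, 'm) monoid_scheme \<Rightarrow> 'g topology \<Rightarrow> ('g \<Rightarrow> 'v \<Rightarrow> 'v) \<Rightarrow> 'v set set \<Rightarrow> bool" where
  "G_complex G T act X \<longleftrightarrow>
     simplicial_complex X \<and>
     (\<forall>g \<in> carrier G. automorphism X (act g)) \<and>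
     (\<forall>v \<in> verts X. act \<one>\<^bsub>G\<^esub> v = v) \<and>
     (\<forall>g \<in> carrier G. \<forall>h \<in> carrier G. \<forall>v \<in> verts X.
         act (g \<otimes>\<^bsub>G\<^esub> h) v = act g (act h v)) \<and>
     (\<forall>g \<in> carrier G. (\<forall>v \<in> verts X. act g v = v) \<longrightarrow> g = \<one>\<^bsub>G\<^esub>) \<and>
     (\<forall>x \<in> X. x \<noteq> {} \<longrightarrow>
         compactin T (cell_stab G act x) \<and> openin T (cell_stab G act x))"

definition cell_orbit :: "('g \<Rightarrow> 'v \<Rightarrow> 'v) \<Rightarrow> 'g set \<Rightarrow> 'v set \<Rightarrow> 'v set set" where
  "cell_orbit act H x = {cell_act act h x | h. h \<in> H}"

text \<open>The quotient \<open>\<Gamma>\<setminus>X\<close> as the set of \<open>\<Gamma>\<close>-orbits of cells.\<close>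

definition quot :: "('g \<Rightarrow> 'v \<Rightarrow> 'v) \<Rightarrow> 'g set \<Rightarrow> 'v set set \<Rightarrow> 'v set set set" where
  "quot act H X = {cell_orbit act H x | x. x \<in> X}"

definition almost_transitive ::
  "('g, 'm) monoid_scheme \<Rightarrow> ('g \<Rightarrow> 'v \<Rightarrow> 'v) \<Rightarrow> 'v set set \<Rightarrow> bool" where
  "almost_transitive G act X \<longleftrightarrow> finite (quot act (carrier G) X)"

text \<open>Order on the quotient poset: \<open>\<Gamma>x \<le> \<Gamma>y\<close> iff \<open>\<gamma>x \<subseteq> y\<close> for some \<open>\<gamma>\<close>.\<close>

definition quot_le :: "'v set set \<Rightarrow> 'v set set \<Rightarrow> bool" where
  "quot_le o1 o2 \<longleftrightarrow> (\<exists>x \<in> o1. \<exists>y \<in> o2. x \<subseteq> y)"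

text \<open>\<open>\<Gamma> \<le>\<^sub>X G\<close>: \<open>\<Gamma>\<close> is a subgroup, the poset \<open>\<Gamma>\<setminus>X\<close> is (order-isomorphic to) a simplicial
  complex \<open>K\<close>, and under this identification \<open>x \<mapsto> \<Gamma>x\<close> is a cover map.\<close>

definition le_X ::
  "('g, 'm) monoid_scheme \<Rightarrow> ('g \<Rightarrow> 'v \<Rightarrow> 'v) \<Rightarrow> 'v set set \<Rightarrow> 'g set \<Rightarrow> bool" where
  "le_X G act X H \<longleftrightarrow> subgroup H G \<and>
     (\<exists>(K :: 'v set set set set) \<phi> f.
        simplicial_complex K \<and>
        bij_betw \<phi> (quot act H X) K \<and>
        (\<forall>p \<in> quot act H X. \<forall>q \<in> quot act H X. quot_le p q \<longleftrightarrow> \<phi> p \<subseteq> \<phi> q) \<and>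
        cover_map X K f \<and>
        (\<forall>x \<in> X. f ` x = \<phi> (cell_orbit act H x)))"

section \<open>The category C(G,X)\<close>

text \<open>The object \<open>X = 1\<setminus>X\<close> (orbits under the trivial group are singletons).\<close>

definition objX :: "('g, 'm) monoid_scheme \<Rightarrow> ('g \<Rightarrow> 'v \<Rightarrow> 'v) \<Rightarrow> 'v set set \<Rightarrow> 'v set set set" where
  "objX G act X = quot act {\<one>\<^bsub>G\<^esub>} X"

definition objs :: "('g, 'm) monoid_scheme \<Rightarrow> ('g \<Rightarrow> 'v \<Rightarrow> 'v) \<Rightarrow> 'v set set \<Rightarrow> 'v set set set set" where
  "objs G act X = insert (objX G act X) {quot act H X | H. le_X G act X H}"

text \<open>Morphisms are represented as (extensional) maps of orbit sets. The map
  \<open>mor act Y Z g\<close> sends an orbit \<open>o \<in> Y\<close> to the orbit of \<open>Z\<close> containing \<open>g o\<close>;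
  for \<open>Y = X\<close> this is \<open>p\<^sub>\<Gamma> \<circ> g\<close>, and with \<open>g = 1\<close> and \<open>Y = \<Gamma>'\<setminus>X\<close> it is \<open>p\<^bsub>\<Gamma>',\<Gamma>\<^esub>\<close>.\<close>

definition mor ::
  "('g \<Rightarrow> 'v \<Rightarrow> 'v) \<Rightarrow> 'v set set set \<Rightarrow> 'v set set set \<Rightarrow> 'g \<Rightarrow> 'v set set \<Rightarrow> 'v set set" where
  "mor act Y Z g c = (if c \<in> Y then (THE z. z \<in> Z \<and> cell_act act g ` c \<subseteq> z) else {})"

definition homs ::
  "('g, 'm) monoid_scheme \<Rightarrow> ('g \<Rightarrow> 'v \<Rightarrow> 'v) \<Rightarrow> 'v set set \<Rightarrow>
   'v set set set \<Rightarrow> 'v set set set \<Rightarrow> ('v set set \<Rightarrow> 'v set set) set" where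
  "homs G act X Y Z =
    (if Y \<in> objs G act X \<and> Z \<in> objs G act X then
       (if Y = objX G act X then {mor act Y Z g | g. g \<in> carrier G}
        else {mor act Y Z \<one>\<^bsub>G\<^esub> | H' H. H' \<noteq> {\<one>\<^bsub>G\<^esub>} \<and> H' \<subseteq> H \<and>
                le_X G act X H' \<and> le_X G act X H \<and>
                Y = quot act H' X \<and> Z = quot act H X})
     else {})"

section \<open>Pre-Hilbert spaces\<close>

record 'h phil =
  pcarrier :: "'h set"
  pzero :: 'h
  padd :: "'h \<Rightarrow> 'h \<Rightarrow> 'h"
  pscale :: "complex \<Rightarrow> 'h \<Rightarrow> 'h"
  pinner :: "'h \<Rightarrow> 'h \<Rightarrow> complex"

text \<open>A complex pre-Hilbert space: a complex vector space with an inner product, linear in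
  the first and conjugate-linear in the second argument (completeness not required).\<close>

definition pre_hilbert :: "'h phil \<Rightarrow> bool" where
  "pre_hilbert V \<longleftrightarrow>
     (let C = pcarrier V; z = pzero V; ad = padd V; sc = pscale V; ip = pinner V in
       z \<in> C \<and> (\<forall>u \<in> C. \<forall>v \<in> C. ad u v \<in> C) \<and> (\<forall>c. \<forall>u \<in> C. sc c u \<in> C) \<and>
       (\<forall>u \<in> C. \<forall>v \<in> C. \<forall>w \<in> C. ad (ad u v) w = ad u (ad v w)) \<and>
       (\<forall>u \<in> C. \<forall>v \<in> C. ad u v = ad v u) \<and>
       (\<forall>u \<in> C. ad z u = u) \<and>
       (\<forall>u \<in> C. \<exists>v \<in> C. ad u v = z) \<and>
       (\<forall>c. \<forall>u \<in> C. \<forall>v \<in> C. sc c (ad u v) = ad (sc c u) (sc c v)) \<and>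
       (\<forall>c d. \<forall>u \<in> C. sc (c + d) u = ad (sc c u) (sc d u)) \<and>
       (\<forall>c d. \<forall>u \<in> C. sc (c * d) u = sc c (sc d u)) \<and>
       (\<forall>u \<in> C. sc 1 u = u) \<and>
       (\<forall>u \<in> C. \<forall>v \<in> C. \<forall>w \<in> C. ip (ad u v) w = ip u w + ip v w) \<and>
       (\<forall>c. \<forall>u \<in> C. \<forall>w \<in> C. ip (sc c u) w = c * ip u w) \<and>
       (\<forall>u \<in> C. \<forall>v \<in> C. ip u v = cnj (ip v u)) \<and>
       (\<forall>u \<in> C. Im (ip u u) = 0 \<and> Re (ip u u) \<ge> 0) \<and>
       (\<forall>u \<in> C. ip u u = 0 \<longrightarrow> u = z))"

definition pnorm :: "'h phil \<Rightarrow> 'h \<Rightarrow> real" where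
  "pnorm V u = sqrt (Re (pinner V u u))"

text \<open>(Not necessarily continuous) linear maps between pre-Hilbert spaces.\<close>

definition lin_map :: "'a phil \<Rightarrow> 'b phil \<Rightarrow> ('a \<Rightarrow> 'b) \<Rightarrow> bool" where
  "lin_map V W f \<longleftrightarrow>
     (\<forall>u \<in> pcarrier V. f u \<in> pcarrier W) \<and>
     (\<forall>u \<in> pcarrier V. \<forall>v \<in> pcarrier V. f (padd V u v) = padd W (f u) (f v)) \<and>
     (\<forall>c. \<forall>u \<in> pcarrier V. f (pscale V c u) = pscale W c (f u))"

text \<open>Unitary maps: linear bijections preserving the inner product.\<close>

definition unitary_map :: "'a phil \<Rightarrow> 'b phil \<Rightarrow> ('a \<Rightarrow> 'b) \<Rightarrow> bool" where
  "unitary_map V W f \<longleftrightarrow> lin_map V W f \<and> bij_betw f (pcarrier V) (pcarrier W) \<and>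
     (\<forall>u \<in> pcarrier V. \<forall>v \<in> pcarrier V. pinner W (f u) (f v) = pinner V u v)"

text \<open>Orthogonal direct sum.\<close>

definition dsum :: "'a phil \<Rightarrow> 'b phil \<Rightarrow> ('a \<times> 'b) phil" where
  "dsum V W = \<lparr> pcarrier = pcarrier V \<times> pcarrier W,
                pzero = (pzero V, pzero W),
                padd = (\<lambda>(u, u') (v, v'). (padd V u v, padd W u' v')),
                pscale = (\<lambda>c (u, u'). (pscale V c u, pscale W c u')),
                pinner = (\<lambda>(u, u') (v, v'). pinner V u v + pinner W u' v') \<rparr>"

text \<open>\<open>\<ell>\<^sup>2\<close>-tilde: finitely supported functions on a set.\<close>

definition l2t :: "'s set \<Rightarrow> ('s \<Rightarrow> complex) phil" where
  "l2t S = \<lparr> pcarrier = {\<phi>. finite {y. \<phi> y \<noteq> 0} \<and> {y. \<phi> y \<noteq> 0} \<subseteq> S},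
            pzero = (\<lambda>_. 0),
            padd = (\<lambda>\<phi> \<psi> y. \<phi> y + \<psi> y),
            pscale = (\<lambda>c \<phi> y. c * \<phi> y),
            pinner = (\<lambda>\<phi> \<psi>. \<Sum>y \<in> {y. \<phi> y \<noteq> 0}. \<phi> y * cnj (\<psi> y)) \<rparr>"

text \<open>Push-forward \<open>f\<^sub>*\<close>.\<close>

definition push :: "('s \<Rightarrow> 't) \<Rightarrow> ('s \<Rightarrow> complex) \<Rightarrow> ('t \<Rightarrow> complex)" where
  "push f \<phi> z = (\<Sum>y \<in> {y. \<phi> y \<noteq> 0 \<and> f y = z}. \<phi> y)"

section \<open>Functors into pHil and into Set\<close>

type_synonym 'v obj = "'v set set set"
type_synonym 'v mor = "'v set set \<Rightarrow> 'v set set"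

text \<open>A functor \<open>C(G,X) \<rightarrow> pHil\<close>: a pre-Hilbert space \<open>Fob Y\<close> for every object and a linear
  map \<open>Fmor Y Z m\<close> for every morphism \<open>m \<in> Hom(Y,Z)\<close>, respecting identities and
  composition.\<close>

definition phil_functor ::
  "('g, 'm) monoid_scheme \<Rightarrow> ('g \<Rightarrow> 'v \<Rightarrow> 'v) \<Rightarrow> 'v set set \<Rightarrow>
   ('v obj \<Rightarrow> 'h phil) \<Rightarrow> ('v obj \<Rightarrow> 'v obj \<Rightarrow> 'v mor \<Rightarrow> 'h \<Rightarrow> 'h) \<Rightarrow> bool" where
  "phil_functor G act X Fob Fmor \<longleftrightarrow>
     (\<forall>Y \<in> objs G act X. pre_hilbert (Fob Y)) \<and>
     (\<forall>Y \<in> objs G act X. \<forall>Z \<in> objs G act X. \<forall>m \<in> homs G act X Y Z.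
         lin_map (Fob Y) (Fob Z) (Fmor Y Z m)) \<and>
     (\<forall>Y \<in> objs G act X. \<forall>m \<in> homs G act X Y Y. (\<forall>c \<in> Y. m c = c) \<longrightarrow>
         (\<forall>u \<in> pcarrier (Fob Y). Fmor Y Y m u = u)) \<and>
     (\<forall>Y \<in> objs G act X. \<forall>Z \<in> objs G act X. \<forall>W \<in> objs G act X.
        \<forall>m \<in> homs G act X Y Z. \<forall>n \<in> homs G act X Z W.
          \<forall>u \<in> pcarrier (Fob Y). Fmor Y W (n \<circ> m) u = Fmor Z W n (Fmor Y Z m u))"

definition set_functor ::
  "('g, 'm) monoid_scheme \<Rightarrow> ('g \<Rightarrow> 'v \<Rightarrow> 'v) \<Rightarrow> 'v set set \<Rightarrow>
   ('v obj \<Rightarrow> 's set) \<Rightarrow> ('v obj \<Rightarrow> 'v obj \<Rightarrow> 'v mor \<Rightarrow> 's \<Rightarrow> 's) \<Rightarrow> bool" where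
  "set_functor G act X S Smor \<longleftrightarrow>
     (\<forall>Y \<in> objs G act X. \<forall>Z \<in> objs G act X. \<forall>m \<in> homs G act X Y Z.
         \<forall>x \<in> S Y. Smor Y Z m x \<in> S Z) \<and>
     (\<forall>Y \<in> objs G act X. \<forall>m \<in> homs G act X Y Y. (\<forall>c \<in> Y. m c = c) \<longrightarrow>
         (\<forall>x \<in> S Y. Smor Y Y m x = x)) \<and>
     (\<forall>Y \<in> objs G act X. \<forall>Z \<in> objs G act X. \<forall>W \<in> objs G act X.
        \<forall>m \<in> homs G act X Y Z. \<forall>n \<in> homs G act X Z W.
          \<forall>x \<in> S Y. Smor Y W (n \<circ> m) x = Smor Z W n (Smor Y Z m x))"

text \<open>The action of \<open>g \<in> G = End(X)\<close> on \<open>SX\<close> via \<open>S\<close>.\<close>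

definition S_act ::
  "('g \<Rightarrow> 'v \<Rightarrow> 'v) \<Rightarrow> 'v obj \<Rightarrow> ('v obj \<Rightarrow> 'v obj \<Rightarrow> 'v mor \<Rightarrow> 's \<Rightarrow> 's) \<Rightarrow> 'g \<Rightarrow> 's \<Rightarrow> 's" where
  "S_act act X0 Smor g = Smor X0 X0 (mor act X0 X0 g)"

text \<open>Elementary functors (conditions E1--E4), for a given functor \<open>S\<close> into Set.\<close>

definition elementary_via ::
  "('g, 'm) monoid_scheme \<Rightarrow> 'g topology \<Rightarrow> ('g \<Rightarrow> 'v \<Rightarrow> 'v) \<Rightarrow> 'v set set \<Rightarrow>
   ('v obj \<Rightarrow> 'h phil) \<Rightarrow> ('v obj \<Rightarrow> 'v obj \<Rightarrow> 'v mor \<Rightarrow> 'h \<Rightarrow> 'h) \<Rightarrow>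
   ('v obj \<Rightarrow> 's set) \<Rightarrow> ('v obj \<Rightarrow> 'v obj \<Rightarrow> 'v mor \<Rightarrow> 's \<Rightarrow> 's) \<Rightarrow> bool" where
  "elementary_via G T act X Fob Fmor S Smor \<longleftrightarrow>
     (let X0 = objX G act X; Ob = objs G act X in
     set_functor G act X S Smor \<and>
     \<comment> \<open>E1: a unitary natural isomorphism \<open>\<ell>\<^sup>2\<circ>S \<cong> F\<close>\<close>
     (\<exists>U :: 'v obj \<Rightarrow> ('s \<Rightarrow> complex) \<Rightarrow> 'h.
        (\<forall>Y \<in> Ob. unitary_map (l2t (S Y)) (Fob Y) (U Y)) \<and>
        (\<forall>Y \<in> Ob. \<forall>Z \<in> Ob. \<forall>m \<in> homs G act X Y Z. \<forall>\<phi> \<in> pcarrier (l2t (S Y)).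
            U Z (push (Smor Y Z m) \<phi>) = Fmor Y Z m (U Y \<phi>))) \<and>
     \<comment> \<open>E2\<close>
     (\<forall>x \<in> S X0. let St = {g \<in> carrier G. S_act act X0 Smor g x = x} in
         compactin T St \<and> openin T St \<and>
         (\<exists>c \<in> X. c \<noteq> {} \<and> St \<subseteq> cell_stab G act c)) \<and>
     \<comment> \<open>E3\<close>
     (\<forall>H. le_X G act X H \<longrightarrow>
         bij_betw (\<lambda>Ob'. the_elem (Smor X0 (quot act H X) (mor act X0 (quot act H X) \<one>\<^bsub>G\<^esub>) ` Ob'))
           {{S_act act X0 Smor h x | h. h \<in> H} | x. x \<in> S X0}
           (S (quot act H X))) \<and>
     \<comment> \<open>E4\<close>
     finite {{S_act act X0 Smor g x | g. g \<in> carrier G} | x. x \<in> S X0})"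

text \<open>The direct sum of two functors into pHil.\<close>

definition dsum_ob :: "('o \<Rightarrow> 'a phil) \<Rightarrow> ('o \<Rightarrow> 'b phil) \<Rightarrow> 'o \<Rightarrow> ('a \<times> 'b) phil" where
  "dsum_ob F F' Y = dsum (F Y) (F' Y)"

definition dsum_mor ::
  "('o \<Rightarrow> 'o \<Rightarrow> 'q \<Rightarrow> 'a \<Rightarrow> 'a) \<Rightarrow> ('o \<Rightarrow> 'o \<Rightarrow> 'q \<Rightarrow> 'b \<Rightarrow> 'b) \<Rightarrow>
   'o \<Rightarrow> 'o \<Rightarrow> 'q \<Rightarrow> 'a \<times> 'b \<Rightarrow> 'a \<times> 'b" where
  "dsum_mor Fm Fm' Y Z m = (\<lambda>(u, u'). (Fm Y Z m u, Fm' Y Z m u'))"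

text \<open>\<open>F\<close> is semi-elementary, witnessed by the complementary functor \<open>F'\<close> and the
  functor \<open>S\<close> into Set making \<open>F \<oplus> F'\<close> elementary.\<close>

definition semi_elementary_via ::
  "('g, 'm) monoid_scheme \<Rightarrow> 'g topology \<Rightarrow> ('g \<Rightarrow> 'v \<Rightarrow> 'v) \<Rightarrow> 'v set set \<Rightarrow>
   ('v obj \<Rightarrow> 'h phil) \<Rightarrow> ('v obj \<Rightarrow> 'v obj \<Rightarrow> 'v mor \<Rightarrow> 'h \<Rightarrow> 'h) \<Rightarrow>
   ('v obj \<Rightarrow> 'j phil) \<Rightarrow> ('v obj \<Rightarrow> 'v obj \<Rightarrow> 'v mor \<Rightarrow> 'j \<Rightarrow> 'j) \<Rightarrow>
   ('v obj \<Rightarrow> 's set) \<Rightarrow> ('v obj \<Rightarrow> 'v obj \<Rightarrow> 'v mor \<Rightarrow> 's \<Rightarrow> 's) \<Rightarrow> bool" where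
  "semi_elementary_via G T act X Fob Fmor Fob' Fmor' S Smor \<longleftrightarrow>
     phil_functor G act X Fob' Fmor' \<and>
     elementary_via G T act X (dsum_ob Fob Fob') (dsum_mor Fmor Fmor') S Smor"

section \<open>(C,F)-operators\<close>

text \<open>Operators are represented as families \<open>a Y\<close> of maps, made extensional: zero outside
  the carrier of \<open>FY\<close>, and \<open>undefined\<close> at non-objects.\<close>

definition op_family ::
  "('g, 'm) monoid_scheme \<Rightarrow> ('g \<Rightarrow> 'v \<Rightarrow> 'v) \<Rightarrow> 'v set set \<Rightarrow>
   ('v obj \<Rightarrow> 'h phil) \<Rightarrow> ('v obj \<Rightarrow> 'h \<Rightarrow> 'h) \<Rightarrow> bool" where
  "op_family G act X Fob a \<longleftrightarrow>
     (\<forall>Y. Y \<notin> objs G act X \<longrightarrow> a Y = undefined) \<and>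
     (\<forall>Y \<in> objs G act X. lin_map (Fob Y) (Fob Y) (a Y) \<and>
        (\<forall>u. u \<notin> pcarrier (Fob Y) \<longrightarrow> a Y u = pzero (Fob Y)))"

definition natural ::
  "('g, 'm) monoid_scheme \<Rightarrow> ('g \<Rightarrow> 'v \<Rightarrow> 'v) \<Rightarrow> 'v set set \<Rightarrow>
   ('v obj \<Rightarrow> 'h phil) \<Rightarrow> ('v obj \<Rightarrow> 'v obj \<Rightarrow> 'v mor \<Rightarrow> 'h \<Rightarrow> 'h) \<Rightarrow>
   ('v obj \<Rightarrow> 'h \<Rightarrow> 'h) \<Rightarrow> bool" where
  "natural G act X Fob Fmor a \<longleftrightarrow>
     op_family G act X Fob a \<and>
     (\<forall>Y \<in> objs G act X. \<forall>Z \<in> objs G act X. \<forall>m \<in> homs G act X Y Z.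
        \<forall>u \<in> pcarrier (Fob Y). a Z (Fmor Y Z m u) = Fmor Y Z m (a Y u))"

definition is_adjoint :: "'h phil \<Rightarrow> ('h \<Rightarrow> 'h) \<Rightarrow> ('h \<Rightarrow> 'h) \<Rightarrow> bool" where
  "is_adjoint V b a \<longleftrightarrow>
     (\<forall>u \<in> pcarrier V. \<forall>v \<in> pcarrier V. pinner V (a u) v = pinner V u (b v))"

definition CF_operators ::
  "('g, 'm) monoid_scheme \<Rightarrow> ('g \<Rightarrow> 'v \<Rightarrow> 'v) \<Rightarrow> 'v set set \<Rightarrow>
   ('v obj \<Rightarrow> 'h phil) \<Rightarrow> ('v obj \<Rightarrow> 'v obj \<Rightarrow> 'v mor \<Rightarrow> 'h \<Rightarrow> 'h) \<Rightarrow>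
   ('v obj \<Rightarrow> 'h \<Rightarrow> 'h) set" where
  "CF_operators G act X Fob Fmor =
     {a. natural G act X Fob Fmor a \<and>
         (\<exists>b. natural G act X Fob Fmor b \<and>
              (\<forall>Y \<in> objs G act X. is_adjoint (Fob Y) (b Y) (a Y)))}"

text \<open>Algebra operations on families (componentwise).\<close>

definition op_add :: "'v set set set set \<Rightarrow> ('v obj \<Rightarrow> 'h phil) \<Rightarrow>
   ('v obj \<Rightarrow> 'h \<Rightarrow> 'h) \<Rightarrow> ('v obj \<Rightarrow> 'h \<Rightarrow> 'h) \<Rightarrow> 'v obj \<Rightarrow> 'h \<Rightarrow> 'h" where
  "op_add Ob Fob a b Y = (if Y \<in> Ob then (\<lambda>u. padd (Fob Y) (a Y u) (b Y u)) else undefined)"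

definition op_scale :: "'v set set set set \<Rightarrow> ('v obj \<Rightarrow> 'h phil) \<Rightarrow>
   complex \<Rightarrow> ('v obj \<Rightarrow> 'h \<Rightarrow> 'h) \<Rightarrow> 'v obj \<Rightarrow> 'h \<Rightarrow> 'h" where
  "op_scale Ob Fob c a Y = (if Y \<in> Ob then (\<lambda>u. pscale (Fob Y) c (a Y u)) else undefined)"

definition op_comp :: "'v set set set set \<Rightarrow>
   ('v obj \<Rightarrow> 'h \<Rightarrow> 'h) \<Rightarrow> ('v obj \<Rightarrow> 'h \<Rightarrow> 'h) \<Rightarrow> 'v obj \<Rightarrow> 'h \<Rightarrow> 'h" where
  "op_comp Ob a b Y = (if Y \<in> Ob then a Y \<circ> b Y else undefined)"

text \<open>\<open>End\<^sub>G(FX)\<close>: G-equivariant linear endomorphisms of \<open>FX\<close> (extensional: zero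
  outside the carrier).\<close>

definition End_G ::
  "('g, 'm) monoid_scheme \<Rightarrow> ('g \<Rightarrow> 'v \<Rightarrow> 'v) \<Rightarrow> 'v set set \<Rightarrow>
   ('v obj \<Rightarrow> 'h phil) \<Rightarrow> ('v obj \<Rightarrow> 'v obj \<Rightarrow> 'v mor \<Rightarrow> 'h \<Rightarrow> 'h) \<Rightarrow> ('h \<Rightarrow> 'h) set" where
  "End_G G act X Fob Fmor =
     (let X0 = objX G act X in
      {t. lin_map (Fob X0) (Fob X0) t \<and>
          (\<forall>u. u \<notin> pcarrier (Fob X0) \<longrightarrow> t u = pzero (Fob X0)) \<and>
          (\<forall>g \<in> carrier G. \<forall>u \<in> pcarrier (Fob X0).
              t (Fmor X0 X0 (mor act X0 X0 g) u) = Fmor X0 X0 (mor act X0 X0 g) (t u))})"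

end

theory Submission
  imports Defs
begin

text \<open>A semi-elementary functor \<open>F\<close> is a natural orthogonal retract of \<open>\<ell>\<^sup>2\<circ>S\<close>. For each quotient
  \<open>Y = \<Gamma>\<setminus>X\<close> the map \<open>P : FX \<rightarrow> FY\<close> is surjective, and since \<open>\<Gamma>\<close> acts freely on \<open>SX\<close>,
  \<open>\<langle>Pu, Pv\<rangle>\<close> is the finite sum of \<open>\<langle>\<gamma>u, v\<rangle>\<close> over \<open>\<gamma> \<in> \<Gamma>\<close>. An equivariant endomorphism \<open>t\<close>
  of \<open>FX\<close> has a matrix with finite columns and, as stabilizers in \<open>SX\<close> are compact open with
  finitely many orbits, also finite rows; hence it has an equivariant adjoint \<open>s\<close>. The summation
  formula yields \<open>\<langle>P(tu), Pv\<rangle> = \<langle>Pu, P(sv)\<rangle>\<close>, so \<open>Pu \<mapsto> P(tu)\<close> is well defined on \<open>FY\<close> with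
  adjoint \<open>Pv \<mapsto> P(sv)\<close>. The \<open>\<ell>\<^sup>1\<close> norms of the matrix columns of \<open>t\<close> and \<open>s\<close> take finitely many
  values and do not grow under push-forward, so Schur's test bounds the operators on all \<open>FY\<close> at
  once.\<close>

section \<open>Pre-Hilbert spaces\<close>

text \<open>The spaces FY are not complete, so no representation theorem hands out adjoints: they
  have to be read off from matrices. A linear endomorphism of finitely supported functions has
  finite columns for free; finite rows are an extra property, and they come from the topology. If
  the column of a base point x is supported on a finite set Z, then the column of gx can be nonzero
  at y only if gz = y for some z in Z. Such g form a coset of the compact stabilizer of y, and since
  the stabilizer of x is open, this coset moves x to finitely many points only. Freeness of \<Gamma>
  on SX has a geometric source: by (E2) an element fixing a point of SX fixes a nonempty cell, and a
  deck transformation of a connected complex that fixes a nonempty cell is trivial. The adjoint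
  serves three purposes: it makes the extension to FY well defined, it provides the adjoint family
  demanded of an operator, and its columns are the rows needed in Schur's test. The complementary
  functor enters only through the inclusion of F into the direct sum and the projection back, which
  are natural and adjoint to each other; through them an endomorphism of FY acquires a matrix
  indexed by SY.\<close>

locale pre_hilbert_space =
  fixes V :: "'h phil"
  assumes pre_hilbert: "pre_hilbert V"
begin

lemma pre_hilbert_axioms:
  "pzero V \<in> pcarrier V"
  "\<forall>u \<in> pcarrier V. \<forall>v \<in> pcarrier V. padd V u v \<in> pcarrier V"
  "\<forall>c. \<forall>u \<in> pcarrier V. pscale V c u \<in> pcarrier V"
  "\<forall>u \<in> pcarrier V. \<forall>v \<in> pcarrier V. \<forall>w \<in> pcarrier V.
    padd V (padd V u v) w = padd V u (padd V v w)"
  "\<forall>u \<in> pcarrier V. \<forall>v \<in> pcarrier V. padd V u v = padd V v u"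
  "\<forall>u \<in> pcarrier V. padd V (pzero V) u = u"
  "\<forall>u \<in> pcarrier V. pscale V 1 u = u"
  "\<forall>c d. \<forall>u \<in> pcarrier V. pscale V (c + d) u = padd V (pscale V c u) (pscale V d u)"
  "\<forall>u \<in> pcarrier V. \<forall>v \<in> pcarrier V. \<forall>w \<in> pcarrier V.
    pinner V (padd V u v) w = pinner V u w + pinner V v w"
  "\<forall>c. \<forall>u \<in> pcarrier V. \<forall>w \<in> pcarrier V. pinner V (pscale V c u) w = c * pinner V u w"
  "\<forall>u \<in> pcarrier V. \<forall>v \<in> pcarrier V. pinner V u v = cnj (pinner V v u)"
  "\<forall>u \<in> pcarrier V. pinner V u u = 0 \<longrightarrow> u = pzero V"
  by (insert pre_hilbert, unfold pre_hilbert_def Let_def, (elim conjE, assumption)+)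

lemmas zero_closed = pre_hilbert_axioms(1)
  and add_closed = pre_hilbert_axioms(2)[rule_format]
  and scale_closed = pre_hilbert_axioms(3)[rule_format]
  and add_assoc = pre_hilbert_axioms(4)[rule_format]
  and add_commute = pre_hilbert_axioms(5)[rule_format]
  and add_zero = pre_hilbert_axioms(6)[rule_format]
  and scale_one = pre_hilbert_axioms(7)[rule_format]
  and scale_add_left = pre_hilbert_axioms(8)[rule_format]
  and inner_add_left = pre_hilbert_axioms(9)[rule_format]
  and inner_scale_left = pre_hilbert_axioms(10)[rule_format]
  and inner_commute = pre_hilbert_axioms(11)[rule_format]
  and inner_definite = pre_hilbert_axioms(12)[rule_format]

lemma inner_add_right:
  assumes "u \<in> pcarrier V" "v \<in> pcarrier V" "w \<in> pcarrier V"
  shows "pinner V u (padd V v w) = pinner V u v + pinner V u w"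
  using assms inner_commute[of u "padd V v w"] inner_commute[of u v] inner_commute[of u w]
  by (simp add: add_closed inner_add_left)

lemma inner_scale_right:
  assumes "u \<in> pcarrier V" "v \<in> pcarrier V"
  shows "pinner V u (pscale V c v) = cnj c * pinner V u v"
  using assms inner_commute[of u "pscale V c v"] inner_commute[of u v]
  by (simp add: scale_closed inner_scale_left)

lemma inner_zero_left: "w \<in> pcarrier V \<Longrightarrow> pinner V (pzero V) w = 0"
  using inner_add_left[of "pzero V" "pzero V" w] by (simp add: zero_closed add_zero)

lemma scale_zero_right: "pscale V c (pzero V) = pzero V"
  by (simp add: inner_definite scale_closed zero_closed inner_scale_left inner_zero_left)

lemma scale_zero_left: "u \<in> pcarrier V \<Longrightarrow> pscale V 0 u = pzero V"
  by (simp add: inner_definite scale_closed inner_scale_left)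

text \<open>Definiteness: the difference is orthogonal to itself. Linearity and equivariance are
  checked below by pairing with test vectors instead of by vector space manipulations.\<close>

lemma vector_eqI:
  assumes u: "u \<in> pcarrier V" and v: "v \<in> pcarrier V"
    and eq: "\<And>w. w \<in> pcarrier V \<Longrightarrow> pinner V u w = pinner V v w"
  shows "u = v"
proof -
  let ?m = "pscale V (-1) v"
  have m: "?m \<in> pcarrier V" and d: "padd V u ?m \<in> pcarrier V"
    using u v by (auto intro: scale_closed add_closed)
  have "pinner V (padd V u ?m) (padd V u ?m) = 0"
    using u v m d eq[OF d] by (simp add: inner_add_left inner_scale_left)
  with d have 0: "padd V u ?m = pzero V" by (rule inner_definite)
  have "padd V ?m v = pscale V (-1 + 1) v"
    using v scale_add_left[of v "-1" 1] by (simp add: scale_one)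
  hence 1: "padd V ?m v = pzero V" using v by (simp add: scale_zero_left)
  have "u = padd V u (padd V ?m v)"
    using u 1 add_commute[of u "pzero V"] by (simp add: add_zero zero_closed)
  also have "\<dots> = v" using u v m 0 by (simp flip: add_assoc add: add_zero)
  finally show ?thesis .
qed

lemma adjoint_swap: "is_adjoint V b a \<Longrightarrow>
    (\<And>u. u \<in> pcarrier V \<Longrightarrow> a u \<in> pcarrier V) \<Longrightarrow>
    (\<And>u. u \<in> pcarrier V \<Longrightarrow> b u \<in> pcarrier V) \<Longrightarrow> is_adjoint V a b"
  unfolding is_adjoint_def by (metis inner_commute)

text \<open>Pairing with test vectors determines the values of \<open>b\<close>, so linearity is
  automatic. An adjoint may therefore be chosen vector by vector.\<close>

lemma adjoint_linear:
  assumes adj: "is_adjoint V b a" and a: "\<And>u. u \<in> pcarrier V \<Longrightarrow> a u \<in> pcarrier V"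
    and b: "\<And>u. u \<in> pcarrier V \<Longrightarrow> b u \<in> pcarrier V"
  shows "lin_map V V b"
proof -
  have ba: "pinner V (b u) w = pinner V u (a w)" if "u \<in> pcarrier V" "w \<in> pcarrier V" for u w
    using adjoint_swap[OF adj a b] that by (simp add: is_adjoint_def)
  show ?thesis unfolding lin_map_def
  proof (intro conjI ballI allI)
    fix u v assume uv: "u \<in> pcarrier V" "v \<in> pcarrier V"
    show "b (padd V u v) = padd V (b u) (b v)"
      by (rule vector_eqI) (use uv in \<open>simp_all add: add_closed b ba inner_add_left a\<close>)
  next
    fix c u assume u: "u \<in> pcarrier V"
    show "b (pscale V c u) = pscale V c (b u)"
      by (rule vector_eqI) (use u in \<open>simp_all add: scale_closed b ba inner_scale_left a\<close>)
  qed (rule b)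
qed

end

lemma lin_map_zero:
  assumes "pre_hilbert V" "pre_hilbert W" "lin_map V W f"
  shows "f (pzero V) = pzero W"
proof -
  interpret V: pre_hilbert_space V by unfold_locales fact
  interpret W: pre_hilbert_space W by unfold_locales fact
  have "f (pscale V 0 (pzero V)) = pscale W 0 (f (pzero V))"
    using assms(3) V.zero_closed by (simp add: lin_map_def)
  thus ?thesis
    using assms(3) V.zero_closed by (simp add: lin_map_def V.scale_zero_right W.scale_zero_left)
qed

lemma lin_map_closed: "lin_map V W f \<Longrightarrow> u \<in> pcarrier V \<Longrightarrow> f u \<in> pcarrier W"
  and lin_map_add: "lin_map V W f \<Longrightarrow> u \<in> pcarrier V \<Longrightarrow> v \<in> pcarrier V \<Longrightarrow>
    f (padd V u v) = padd W (f u) (f v)"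
  and lin_map_scale: "lin_map V W f \<Longrightarrow> u \<in> pcarrier V \<Longrightarrow> f (pscale V c u) = pscale W c (f u)"
  by (simp_all add: lin_map_def)

lemma lin_map_comp: "lin_map V W f \<Longrightarrow> lin_map W Z g \<Longrightarrow> lin_map V Z (\<lambda>u. g (f u))"
  by (simp add: lin_map_def)

context pre_hilbert_space
begin

lemma lin_map_sum:
  assumes "lin_map V V a" "lin_map V V b"
  shows "lin_map V V (\<lambda>u. padd V (a u) (b u))"
  unfolding lin_map_def
proof (intro conjI ballI allI)
  fix u v assume uv: "u \<in> pcarrier V" "v \<in> pcarrier V"
  note cl = uv assms[THEN lin_map_closed] add_closed
  show "padd V (a (padd V u v)) (b (padd V u v)) = padd V (padd V (a u) (b u)) (padd V (a v) (b v))"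
    by (rule vector_eqI) (simp_all add: cl assms[THEN lin_map_add] inner_add_left)
next
  fix c u assume u: "u \<in> pcarrier V"
  note cl = u assms[THEN lin_map_closed] add_closed scale_closed
  show "padd V (a (pscale V c u)) (b (pscale V c u)) = pscale V c (padd V (a u) (b u))"
    by (rule vector_eqI)
      (simp_all add: cl assms[THEN lin_map_scale] inner_add_left inner_scale_left distrib_left)
qed (simp add: assms[THEN lin_map_closed] add_closed)

lemma lin_map_multiple:
  assumes "lin_map V V a"
  shows "lin_map V V (\<lambda>u. pscale V c (a u))"
  unfolding lin_map_def
proof (intro conjI ballI allI)
  fix u v assume uv: "u \<in> pcarrier V" "v \<in> pcarrier V"
  note cl = uv assms[THEN lin_map_closed] add_closed scale_closed
  show "pscale V c (a (padd V u v)) = padd V (pscale V c (a u)) (pscale V c (a v))"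
    by (rule vector_eqI)
      (simp_all add: cl assms[THEN lin_map_add] inner_add_left inner_scale_left distrib_left)
next
  fix d u assume u: "u \<in> pcarrier V"
  note cl = u assms[THEN lin_map_closed] scale_closed
  show "pscale V c (a (pscale V d u)) = pscale V d (pscale V c (a u))"
    by (rule vector_eqI)
      (simp_all add: cl assms[THEN lin_map_scale] inner_scale_left)
qed (simp add: assms[THEN lin_map_closed] scale_closed)

end

section \<open>Finitely supported functions\<close>

abbreviation supp :: "('s \<Rightarrow> complex) \<Rightarrow> 's set" where
  "supp \<phi> \<equiv> {y. \<phi> y \<noteq> 0}"

definition delta :: "'s \<Rightarrow> 's \<Rightarrow> complex" where
  "delta x y = (if y = x then 1 else 0)"

definition l1 :: "('s \<Rightarrow> complex) \<Rightarrow> real" where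
  "l1 \<phi> = (\<Sum>y \<in> supp \<phi>. cmod (\<phi> y))"

lemma l2t_simps [simp]:
  "\<phi> \<in> pcarrier (l2t S) \<longleftrightarrow> finite (supp \<phi>) \<and> supp \<phi> \<subseteq> S"
  "padd (l2t S) \<phi> \<psi> = (\<lambda>y. \<phi> y + \<psi> y)"
  "pscale (l2t S) c \<phi> = (\<lambda>y. c * \<phi> y)"
  "pzero (l2t S) = (\<lambda>_. 0)"
  by (simp_all add: l2t_def)

lemma delta_closed: "x \<in> S \<Longrightarrow> delta x \<in> pcarrier (l2t S)"
  by (auto simp: delta_def)

lemma l2t_inner_left:
  assumes "finite A" "supp \<phi> \<subseteq> A"
  shows "pinner (l2t S) \<phi> \<psi> = (\<Sum>y\<in>A. \<phi> y * cnj (\<psi> y))"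
  using assms by (auto simp: l2t_def intro!: sum.mono_neutral_left)

text \<open>\<open>pinner\<close> sums over the support of its first argument; here the sum is moved
  to the second. Finiteness of \<open>supp \<phi>\<close> matters because a sum over an infinite set
  is 0 by convention.\<close>

lemma l2t_inner_right:
  assumes "finite (supp \<phi>)" "finite A" "supp \<psi> \<subseteq> A"
  shows "pinner (l2t S) \<phi> \<psi> = (\<Sum>y\<in>A. \<phi> y * cnj (\<psi> y))"
proof -
  have "pinner (l2t S) \<phi> \<psi> = (\<Sum>y\<in>A \<union> supp \<phi>. \<phi> y * cnj (\<psi> y))"
    using assms by (intro l2t_inner_left) auto
  also have "\<dots> = (\<Sum>y\<in>A. \<phi> y * cnj (\<psi> y))"
    using assms by (intro sum.mono_neutral_right) auto
  finally show ?thesis .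
qed

lemma l2t_inner_commute:
  assumes "finite (supp \<phi>)" "finite (supp \<psi>)"
  shows "pinner (l2t S) \<phi> \<psi> = cnj (pinner (l2t S) \<psi> \<phi>)"
  using assms l2t_inner_left[of "supp \<phi> \<union> supp \<psi>"] by (simp add: mult.commute)

lemma l2t_inner_delta_right: "finite (supp \<phi>) \<Longrightarrow> pinner (l2t S) \<phi> (delta y) = \<phi> y"
  by (subst l2t_inner_right[of _ "{y}"]) (auto simp: delta_def)

lemma l2t_inner_delta_left: "pinner (l2t S) (delta x) \<psi> = cnj (\<psi> x)"
  by (subst l2t_inner_left[of "{x}"]) (auto simp: delta_def)

lemma l2t_inner_self: "pinner (l2t S) \<phi> \<phi> = of_real (\<Sum>y\<in>supp \<phi>. (cmod (\<phi> y))\<^sup>2)"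
  unfolding l2t_def by (simp only: phil.simps of_real_sum complex_norm_square)

lemma supp_push: "supp (push f \<phi>) \<subseteq> f ` supp \<phi>"
proof
  fix z assume "z \<in> supp (push f \<phi>)"
  hence "(\<Sum>y \<in> {y. \<phi> y \<noteq> 0 \<and> f y = z}. \<phi> y) \<noteq> 0" by (simp add: push_def)
  hence "{y. \<phi> y \<noteq> 0 \<and> f y = z} \<noteq> {}" by (metis sum.empty)
  thus "z \<in> f ` supp \<phi>" by auto
qed

lemma push_closed:
  assumes "\<phi> \<in> pcarrier (l2t S)" "f ` S \<subseteq> S'"
  shows "push f \<phi> \<in> pcarrier (l2t S')"
proof -
  have "finite (supp (push f \<phi>))"
    by (rule finite_subset[OF supp_push]) (use assms in simp)
  moreover have "f ` supp \<phi> \<subseteq> S'" using assms by auto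
  ultimately show ?thesis using supp_push[of f \<phi>] by (simp add: order_trans)
qed

lemma push_superset:
  assumes "finite A" "supp \<phi> \<subseteq> A"
  shows "push f \<phi> z = (\<Sum>y \<in> {y \<in> A. f y = z}. \<phi> y)"
  using assms unfolding push_def by (intro sum.mono_neutral_left) auto

lemma push_delta: "push f (delta x) = delta (f x)"
proof
  fix z
  have "{y \<in> {x}. f y = z} = (if z = f x then {x} else {})" by auto
  thus "push f (delta x) z = delta (f x) z"
    by (subst push_superset[of "{x}"]) (auto simp: delta_def)
qed

lemma push_inj:
  assumes "inj_on f S" "supp \<phi> \<subseteq> S" "x \<in> S"
  shows "push f \<phi> (f x) = \<phi> x"
proof -
  have "{y. \<phi> y \<noteq> 0 \<and> f y = f x} = (if \<phi> x = 0 then {} else {x})"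
    using assms by (auto dest: inj_onD)
  thus ?thesis by (simp add: push_def)
qed

text \<open>The preimage is the push-forward of \<open>\<psi>\<close> along a section of
  \<open>f\<close>.\<close>

lemma push_surj:
  assumes "f ` S = S'" "\<psi> \<in> pcarrier (l2t S')"
  shows "\<exists>\<phi> \<in> pcarrier (l2t S). push f \<phi> = \<psi>"
proof -
  define s where "s = inv_into S f"
  have s: "s z \<in> S" "f (s z) = z" if "z \<in> S'" for z
    using assms(1) that by (auto simp: s_def inv_into_into f_inv_into_f)
  define \<phi> where "\<phi> = push s \<psi>"
  have "\<phi> \<in> pcarrier (l2t S)" unfolding \<phi>_def by (rule push_closed[OF assms(2)]) (use s in auto)
  moreover have "push f \<phi> = \<psi>"
  proof
    fix z
    have inj: "inj_on s S'" using s by (metis inj_onI)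
    have supp\<phi>: "supp \<phi> \<subseteq> s ` supp \<psi>" unfolding \<phi>_def by (rule supp_push)
    \<comment> \<open>The section picks one point per fibre, so pushing back along \<open>f\<close>
      involves no cancellation.\<close>
    have *: "{y. \<phi> y \<noteq> 0 \<and> f y = z} = (if \<psi> z = 0 then {} else {s z})"
      using supp\<phi> s assms(2) push_inj[OF inj, of \<psi>] unfolding \<phi>_def[symmetric]
      by (auto simp: subset_iff image_iff)
    show "push f \<phi> z = \<psi> z"
      using assms(2) push_inj[OF inj, of \<psi> z] unfolding push_def[of f] * \<phi>_def[symmetric] by auto
  qed
  ultimately show ?thesis by blast
qed

lemma l1_superset: "finite A \<Longrightarrow> supp \<phi> \<subseteq> A \<Longrightarrow> l1 \<phi> = (\<Sum>y\<in>A. cmod (\<phi> y))"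
  unfolding l1_def by (intro sum.mono_neutral_left) auto

lemma sum_le_l1:
  assumes "finite (supp \<phi>)" "finite A"
  shows "(\<Sum>y\<in>A. cmod (\<phi> y)) \<le> l1 \<phi>"
  using assms by (subst l1_superset[of "A \<union> supp \<phi>"]) (auto intro: sum_mono2)

text \<open>Triangle inequality in each fibre. This is why column bounds on SX survive in every
  quotient with the same constant.\<close>

lemma l1_push_le:
  assumes "finite (supp \<phi>)"
  shows "l1 (push f \<phi>) \<le> l1 \<phi>"
proof -
  have "l1 (push f \<phi>) = (\<Sum>z \<in> f ` supp \<phi>. cmod (push f \<phi> z))"
    by (intro l1_superset supp_push finite_imageI assms)
  also have "\<dots> \<le> (\<Sum>z \<in> f ` supp \<phi>. \<Sum>y \<in> {y \<in> supp \<phi>. f y = z}. cmod (\<phi> y))"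
    by (intro sum_mono) (auto simp: push_def intro: norm_sum)
  also have "\<dots> = l1 \<phi>" unfolding l1_def by (rule sum.image_gen[OF assms, symmetric])
  finally show ?thesis .
qed

text \<open>Push-forward is adjoint to pull-back. The pull-back of \<open>\<psi>\<close> may have
  infinite support, for instance when a fibre is infinite, so the right-hand side is an explicit sum
  over \<open>supp \<phi>\<close> rather than an inner product with an element of the space.\<close>

lemma inner_push_left:
  assumes "finite (supp \<phi>)"
  shows "pinner (l2t S) (push f \<phi>) \<psi> = (\<Sum>x\<in>supp \<phi>. \<phi> x * cnj (\<psi> (f x)))"
proof -
  have "pinner (l2t S) (push f \<phi>) \<psi> = (\<Sum>z \<in> f ` supp \<phi>. push f \<phi> z * cnj (\<psi> z))"
    by (intro l2t_inner_left supp_push finite_imageI assms)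
  also have "\<dots> = (\<Sum>z \<in> f ` supp \<phi>. \<Sum>x \<in> {x \<in> supp \<phi>. f x = z}. \<phi> x * cnj (\<psi> (f x)))"
    by (intro sum.cong) (auto simp: push_def sum_distrib_right intro!: sum.cong)
  also have "\<dots> = (\<Sum>x\<in>supp \<phi>. \<phi> x * cnj (\<psi> (f x)))"
    using sum.image_gen[OF assms, of "\<lambda>x. \<phi> x * cnj (\<psi> (f x))" f] by simp
  finally show ?thesis .
qed

text \<open>The unfolding formula: each fibre of \<open>\<pi>\<close> is a free orbit, so the value
  of \<open>push \<pi> \<psi>\<close> at \<open>\<pi> x\<close> is a sum of \<open>\<psi>\<close>
  over the translates of \<open>x\<close>. The set \<open>B\<close> is any finite part of
  \<open>H\<close> containing all contributing elements; this freedom allows two such formulas to be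
  compared over a common index set.\<close>

lemma inner_push_free_quotient:
  assumes \<phi>: "\<phi> \<in> pcarrier (l2t S)" and \<psi>: "\<psi> \<in> pcarrier (l2t S)"
    and fibre: "\<And>x y. x \<in> S \<Longrightarrow> y \<in> S \<Longrightarrow> \<pi> x = \<pi> y \<longleftrightarrow> (\<exists>h\<in>H. \<sigma> h x = y)"
    and free: "\<And>x h k. x \<in> S \<Longrightarrow> h \<in> H \<Longrightarrow> k \<in> H \<Longrightarrow> \<sigma> h x = \<sigma> k x \<Longrightarrow> h = k"
    and B: "finite B" "B \<subseteq> H" "{h \<in> H. \<exists>x \<in> supp \<phi>. \<sigma> h x \<in> supp \<psi>} \<subseteq> B"
  shows "pinner (l2t S') (push \<pi> \<phi>) (push \<pi> \<psi>) = (\<Sum>h\<in>B. pinner (l2t S) (push (\<sigma> h) \<phi>) \<psi>)"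
proof -
  have fin: "finite (supp \<phi>)" "finite (supp \<psi>)" using \<phi> \<psi> by auto
  have *: "push \<pi> \<psi> (\<pi> x) = (\<Sum>h\<in>B. \<psi> (\<sigma> h x))" if x: "x \<in> supp \<phi>" for x
  proof -
    have xS: "x \<in> S" using \<phi> x by auto
    have "(\<Sum>h\<in>B. \<psi> (\<sigma> h x)) = (\<Sum>h\<in>{h\<in>B. \<psi> (\<sigma> h x) \<noteq> 0}. \<psi> (\<sigma> h x))"
      using B(1) by (intro sum.mono_neutral_right) auto
    \<comment> \<open>Reindexing by the orbit map of \<open>x\<close>: freeness makes it injective,
      and \<open>fibre\<close> together with the lower bound on \<open>B\<close> makes it surjective
      onto the part of the fibre inside \<open>supp \<psi>\<close>.\<close>
    also have "\<dots> = (\<Sum>y\<in>{y. \<psi> y \<noteq> 0 \<and> \<pi> y = \<pi> x}. \<psi> y)"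
    proof (rule sum.reindex_bij_betw)
      show "bij_betw (\<lambda>h. \<sigma> h x) {h\<in>B. \<psi> (\<sigma> h x) \<noteq> 0} {y. \<psi> y \<noteq> 0 \<and> \<pi> y = \<pi> x}"
        unfolding bij_betw_def
      proof
        show "inj_on (\<lambda>h. \<sigma> h x) {h\<in>B. \<psi> (\<sigma> h x) \<noteq> 0}"
          using free[OF xS] B(2) by (auto simp: inj_on_def)
        show "(\<lambda>h. \<sigma> h x) ` {h\<in>B. \<psi> (\<sigma> h x) \<noteq> 0} = {y. \<psi> y \<noteq> 0 \<and> \<pi> y = \<pi> x}"
        proof (intro equalityI subsetI)
          fix y assume "y \<in> (\<lambda>h. \<sigma> h x) ` {h\<in>B. \<psi> (\<sigma> h x) \<noteq> 0}"
          then obtain h where h: "h \<in> H" "\<sigma> h x = y" "\<psi> y \<noteq> 0" using B(2) by auto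
          moreover have "y \<in> S" using h(3) \<psi> by auto
          ultimately show "y \<in> {y. \<psi> y \<noteq> 0 \<and> \<pi> y = \<pi> x}"
            using fibre[OF xS, of y] by auto
        next
          fix y assume y: "y \<in> {y. \<psi> y \<noteq> 0 \<and> \<pi> y = \<pi> x}"
          then obtain h where "h \<in> H" "\<sigma> h x = y" using fibre[OF xS, of y] \<psi> by auto
          thus "y \<in> (\<lambda>h. \<sigma> h x) ` {h\<in>B. \<psi> (\<sigma> h x) \<noteq> 0}" using B(3) x y by auto
        qed
      qed
    qed
    finally show ?thesis by (simp add: push_def)
  qed
  have "pinner (l2t S') (push \<pi> \<phi>) (push \<pi> \<psi>) =
      (\<Sum>x\<in>supp \<phi>. \<Sum>h\<in>B. \<phi> x * cnj (\<psi> (\<sigma> h x)))"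
    using * by (simp add: inner_push_left fin sum_distrib_left)
  also have "\<dots> = (\<Sum>h\<in>B. pinner (l2t S) (push (\<sigma> h) \<phi>) \<psi>)"
    by (subst sum.swap) (simp add: inner_push_left fin)
  finally show ?thesis .
qed

text \<open>Matrix form of \<open>t\<close>: the entry in row \<open>y\<close> and column
  \<open>x\<close> is \<open>t (delta x) y\<close>.\<close>

lemma lin_map_l2t_expand:
  assumes t: "lin_map (l2t S) (l2t S') t" and \<phi>: "\<phi> \<in> pcarrier (l2t S)"
  shows "t \<phi> y = (\<Sum>x\<in>supp \<phi>. \<phi> x * t (delta x) y)"
proof -
  have "finite A \<Longrightarrow> A \<subseteq> S \<Longrightarrow>
      t (\<lambda>z. \<Sum>x\<in>A. \<phi> x * delta x z) = (\<lambda>y. \<Sum>x\<in>A. \<phi> x * t (delta x) y)" for A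
  proof (induction A rule: finite_induct)
    case empty
    have "t (pscale (l2t S) 0 (\<lambda>_. 0)) = pscale (l2t S') 0 (t (\<lambda>_. 0))"
      using t unfolding lin_map_def by (auto simp del: l2t_simps(3))
    thus ?case by simp
  next
    case (insert a A)
    let ?s = "\<lambda>z. \<Sum>x\<in>A. \<phi> x * delta x z"
    have "supp ?s \<subseteq> A" by (auto simp: delta_def elim!: sum.not_neutral_contains_not_neutral split: if_splits)
    hence s: "?s \<in> pcarrier (l2t S)" using insert by (auto intro: finite_subset)
    have d: "pscale (l2t S) (\<phi> a) (delta a) \<in> pcarrier (l2t S)"
      using insert.prems by (auto simp: delta_def)
    have "t (padd (l2t S) (pscale (l2t S) (\<phi> a) (delta a)) ?s) =
        padd (l2t S') (pscale (l2t S') (\<phi> a) (t (delta a))) (t ?s)"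
    proof -
      have "t (padd (l2t S) (pscale (l2t S) (\<phi> a) (delta a)) ?s) =
          padd (l2t S') (t (pscale (l2t S) (\<phi> a) (delta a))) (t ?s)"
        using t s d unfolding lin_map_def by blast
      moreover have "t (pscale (l2t S) (\<phi> a) (delta a)) = pscale (l2t S') (\<phi> a) (t (delta a))"
        using t delta_closed[of a S] insert.prems unfolding lin_map_def by blast
      ultimately show ?thesis by simp
    qed
    thus ?case using insert by simp
  qed
  moreover have "\<phi> = (\<lambda>z. \<Sum>x\<in>supp \<phi>. \<phi> x * delta x z)"
  proof
    fix z
    have "(\<Sum>x\<in>supp \<phi>. \<phi> x * delta x z) = (\<Sum>x\<in>supp \<phi>. if z = x then \<phi> x else 0)"
      by (intro sum.cong) (auto simp: delta_def)
    thus "\<phi> z = (\<Sum>x\<in>supp \<phi>. \<phi> x * delta x z)" using \<phi> by (simp add: sum.delta)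
  qed
  hence "t \<phi> = t (\<lambda>z. \<Sum>x\<in>supp \<phi>. \<phi> x * delta x z)" by (rule arg_cong)
  ultimately show ?thesis using \<phi> by simp
qed

text \<open>Without completeness a linear functional need not be represented by a vector. Finite
  rows are what makes the only candidate finitely supported.\<close>

lemma l2t_adjoint_vector:
  assumes t: "lin_map (l2t S) (l2t S) t"
    and rows: "\<And>y. y \<in> S \<Longrightarrow> finite {x \<in> S. t (delta x) y \<noteq> 0}"
    and \<psi>: "\<psi> \<in> pcarrier (l2t S)"
  shows "\<exists>\<eta> \<in> pcarrier (l2t S). \<forall>\<phi> \<in> pcarrier (l2t S). pinner (l2t S) (t \<phi>) \<psi> = pinner (l2t S) \<phi> \<eta>"
proof -
  have ip: "pinner (l2t S) \<theta> \<psi> = (\<Sum>y\<in>supp \<psi>. \<theta> y * cnj (\<psi> y))" if "\<theta> \<in> pcarrier (l2t S)" for \<theta>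
    using that \<psi> by (intro l2t_inner_right) auto
  have td: "t (delta x) \<in> pcarrier (l2t S)" if "x \<in> S" for x
    using t delta_closed[OF that] unfolding lin_map_def by blast
  \<comment> \<open>The value at \<open>x\<close> is forced by testing the desired identity on
    \<open>delta x\<close>.\<close>
  define \<eta> where "\<eta> x = (if x \<in> S then cnj (pinner (l2t S) (t (delta x)) \<psi>) else 0)" for x
  have "supp \<eta> \<subseteq> (\<Union>y\<in>supp \<psi>. {x \<in> S. t (delta x) y \<noteq> 0})"
  proof
    fix x assume "x \<in> supp \<eta>"
    hence x: "x \<in> S" "pinner (l2t S) (t (delta x)) \<psi> \<noteq> 0" by (auto simp: \<eta>_def split: if_splits)
    hence "(\<Sum>y\<in>supp \<psi>. t (delta x) y * cnj (\<psi> y)) \<noteq> 0" using ip[OF td] by simp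
    then obtain y where "y \<in> supp \<psi>" "t (delta x) y * cnj (\<psi> y) \<noteq> 0"
      by (rule sum.not_neutral_contains_not_neutral)
    thus "x \<in> (\<Union>y\<in>supp \<psi>. {x \<in> S. t (delta x) y \<noteq> 0})" using x by auto
  qed
  moreover have "finite (\<Union>y\<in>supp \<psi>. {x \<in> S. t (delta x) y \<noteq> 0})"
    using \<psi> rows by auto
  ultimately have "finite (supp \<eta>)" by (rule finite_subset)
  hence \<eta>: "\<eta> \<in> pcarrier (l2t S)" by (auto simp: \<eta>_def)
  moreover have "pinner (l2t S) (t \<phi>) \<psi> = pinner (l2t S) \<phi> \<eta>" if \<phi>: "\<phi> \<in> pcarrier (l2t S)" for \<phi>
  proof -
    have "t \<phi> \<in> pcarrier (l2t S)" using t \<phi> unfolding lin_map_def by blast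
    hence "pinner (l2t S) (t \<phi>) \<psi> = (\<Sum>y\<in>supp \<psi>. \<Sum>x\<in>supp \<phi>. \<phi> x * (t (delta x) y * cnj (\<psi> y)))"
      by (simp only: ip lin_map_l2t_expand[OF t \<phi>] sum_distrib_right mult.assoc)
    also have "\<dots> = (\<Sum>x\<in>supp \<phi>. \<phi> x * pinner (l2t S) (t (delta x)) \<psi>)"
      using \<phi> by (subst sum.swap) (auto simp: ip[OF td] sum_distrib_left subset_iff intro!: sum.cong)
    also have "\<dots> = (\<Sum>x\<in>supp \<phi>. \<phi> x * cnj (\<eta> x))"
      using \<phi> by (intro sum.cong) (auto simp: \<eta>_def)
    also have "\<dots> = pinner (l2t S) \<phi> \<eta>" by (simp add: l2t_def)
    finally show ?thesis .
  qed
  ultimately show ?thesis by blast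
qed

text \<open>Schur's test with constant weights: column sums bounded by \<open>M\<close> and row sums
  bounded by \<open>M\<close> give operator norm at most \<open>M\<close>. The row sums are supplied
  as column sums of the adjoint.\<close>

lemma l2t_schur_test:
  assumes a: "lin_map (l2t S) (l2t S) a" and b: "lin_map (l2t S) (l2t S) b"
    and adj: "is_adjoint (l2t S) b a"
    and col: "\<And>x. x \<in> S \<Longrightarrow> l1 (a (delta x)) \<le> M" and row: "\<And>y. y \<in> S \<Longrightarrow> l1 (b (delta y)) \<le> M"
    and M: "0 \<le> M" and \<phi>: "\<phi> \<in> pcarrier (l2t S)"
  shows "pnorm (l2t S) (a \<phi>) \<le> M * pnorm (l2t S) \<phi>"
proof -
  have norm2: "(pnorm (l2t S) \<psi>)\<^sup>2 = (\<Sum>y\<in>supp \<psi>. (cmod (\<psi> y))\<^sup>2)" for \<psi>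
    by (simp add: pnorm_def l2t_inner_self sum_nonneg)
  define k where "k y x = cmod (a (delta x) y)" for y x
  have carr: "a \<theta> \<in> pcarrier (l2t S)" "b \<theta> \<in> pcarrier (l2t S)" if "\<theta> \<in> pcarrier (l2t S)" for \<theta>
    using a b that unfolding lin_map_def by blast+
  define P where "P = supp \<phi>"
  define Q where "Q = supp (a \<phi>)"
  have P: "finite P" "P \<subseteq> S" using \<phi> by (auto simp: P_def)
  have Q: "finite Q" "Q \<subseteq> S" using carr(1)[OF \<phi>] by (auto simp: Q_def)
  have colsum: "(\<Sum>y\<in>Q. k y x) \<le> M" if "x \<in> P" for x
    using sum_le_l1[of "a (delta x)" Q] carr(1)[OF delta_closed, of x] col[of x] that P Q
    by (fastforce simp: k_def)
  have rowsum: "(\<Sum>x\<in>P. k y x) \<le> M" if y: "y \<in> Q" for y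
  proof -
    \<comment> \<open>The matrix of \<open>b\<close> is the conjugate transpose of that of
      \<open>a\<close>.\<close>
    have "k y x = cmod (b (delta y) x)" if x: "x \<in> P" for x
    proof -
      have d: "delta x \<in> pcarrier (l2t S)" "delta y \<in> pcarrier (l2t S)"
        using x y P Q by (auto intro!: delta_closed simp del: l2t_simps(1))
      have "a (delta x) y = pinner (l2t S) (a (delta x)) (delta y)"
        using carr(1)[OF d(1)] by (simp add: l2t_inner_delta_right)
      also have "\<dots> = cnj (b (delta y) x)"
        using adj d unfolding is_adjoint_def by (metis l2t_inner_delta_left)
      finally show ?thesis by (simp add: k_def)
    qed
    hence "(\<Sum>x\<in>P. k y x) = (\<Sum>x\<in>P. cmod (b (delta y) x))" by simp
    also have "\<dots> \<le> l1 (b (delta y))"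
      using carr(2)[OF delta_closed, of y] y P Q by (intro sum_le_l1) auto
    finally show ?thesis using row[of y] y Q by auto
  qed
  have cs: "(cmod (a \<phi> y))\<^sup>2 \<le> M * (\<Sum>x\<in>P. k y x * (cmod (\<phi> x))\<^sup>2)" if y: "y \<in> Q" for y
  proof -
    have "cmod (a \<phi> y) \<le> (\<Sum>x\<in>P. k y x * cmod (\<phi> x))"
      unfolding lin_map_l2t_expand[OF a \<phi>] P_def
      by (rule order_trans[OF norm_sum]) (simp add: norm_mult k_def mult.commute)
    \<comment> \<open>One factor \<open>sqrt (k y x)\<close> is left alone, so that Cauchy-Schwarz
      separates a row sum from the weighted squares of \<open>\<phi>\<close>.\<close>
    also have "\<dots> = (\<Sum>x\<in>P. sqrt (k y x) * (sqrt (k y x) * cmod (\<phi> x)))"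
      by (simp add: k_def flip: mult.assoc)
    finally have "(cmod (a \<phi> y))\<^sup>2 \<le> (\<Sum>x\<in>P. sqrt (k y x) * (sqrt (k y x) * cmod (\<phi> x)))\<^sup>2"
      by (intro power_mono) auto
    also have "\<dots> \<le> (\<Sum>x\<in>P. (sqrt (k y x))\<^sup>2) * (\<Sum>x\<in>P. (sqrt (k y x) * cmod (\<phi> x))\<^sup>2)"
      by (rule Cauchy_Schwarz_ineq_sum)
    also have "\<dots> = (\<Sum>x\<in>P. k y x) * (\<Sum>x\<in>P. k y x * (cmod (\<phi> x))\<^sup>2)"
      by (simp add: k_def power_mult_distrib)
    also have "\<dots> \<le> M * (\<Sum>x\<in>P. k y x * (cmod (\<phi> x))\<^sup>2)"
      using rowsum[OF y] by (intro mult_right_mono sum_nonneg) (auto simp: k_def)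
    finally show ?thesis .
  qed
  have "(pnorm (l2t S) (a \<phi>))\<^sup>2 \<le> (\<Sum>y\<in>Q. M * (\<Sum>x\<in>P. k y x * (cmod (\<phi> x))\<^sup>2))"
    unfolding norm2 Q_def[symmetric] by (intro sum_mono cs)
  also have "\<dots> = M * (\<Sum>y\<in>Q. \<Sum>x\<in>P. k y x * (cmod (\<phi> x))\<^sup>2)"
    by (simp add: sum_distrib_left)
  also have "\<dots> = M * (\<Sum>x\<in>P. (\<Sum>y\<in>Q. k y x) * (cmod (\<phi> x))\<^sup>2)"
    by (subst sum.swap) (simp add: sum_distrib_right)
  also have "\<dots> \<le> M * (\<Sum>x\<in>P. M * (cmod (\<phi> x))\<^sup>2)"
    using colsum M by (intro mult_left_mono sum_mono mult_right_mono) auto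
  also have "\<dots> = (M * pnorm (l2t S) \<phi>)\<^sup>2"
    by (simp add: norm2 P_def power_mult_distrib power2_eq_square[of M] sum_distrib_left mult.assoc)
  finally have "pnorm (l2t S) (a \<phi>) \<le> \<bar>M * pnorm (l2t S) \<phi>\<bar>"
    by (metis abs_ge_self abs_le_square_iff order_trans)
  moreover have "0 \<le> pnorm (l2t S) \<phi>" by (simp add: pnorm_def l2t_inner_self sum_nonneg)
  ultimately show ?thesis using M by (simp add: abs_of_nonneg)
qed

section \<open>Quotients of a G-complex\<close>

locale G_complex_setting =
  fixes G :: "('g, 'm) monoid_scheme" (structure) and T :: "'g topology"
    and act :: "'g \<Rightarrow> 'v \<Rightarrow> 'v" and X :: "'v set set"
  assumes l_group: "l_group G T" and G_complex: "G_complex G T act X"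
begin

abbreviation "X0 \<equiv> objX G act X"
abbreviation "Ob \<equiv> objs G act X"

sublocale group G using l_group by (simp add: l_group_def)

lemma simplicial: "simplicial_complex X"
  using G_complex by (simp add: G_complex_def)

lemma cell_subset_verts: "x \<in> X \<Longrightarrow> x \<subseteq> verts X"
  using simplicial unfolding simplicial_complex_def verts_def by blast

lemma automorphism_act: "g \<in> carrier G \<Longrightarrow> automorphism X (act g)"
  and act_one: "v \<in> verts X \<Longrightarrow> act \<one> v = v"
  and act_mult: "g \<in> carrier G \<Longrightarrow> h \<in> carrier G \<Longrightarrow> v \<in> verts X \<Longrightarrow>
    act (g \<otimes> h) v = act g (act h v)"
  and act_faithful: "g \<in> carrier G \<Longrightarrow> (\<And>v. v \<in> verts X \<Longrightarrow> act g v = v) \<Longrightarrow> g = \<one>"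
  using G_complex by (simp_all add: G_complex_def)

lemma cell_act_closed: "g \<in> carrier G \<Longrightarrow> x \<in> X \<Longrightarrow> cell_act act g x \<in> X"
  using automorphism_act[of g] cell_subset_verts[of x] by (simp add: automorphism_def cell_act_def)

lemma cell_act_mult: "g \<in> carrier G \<Longrightarrow> h \<in> carrier G \<Longrightarrow> x \<in> X \<Longrightarrow>
    cell_act act (g \<otimes> h) x = cell_act act g (cell_act act h x)"
  unfolding cell_act_def image_image by (intro image_cong refl act_mult) (use cell_subset_verts in auto)

lemma cell_act_one: "x \<in> X \<Longrightarrow> cell_act act \<one> x = x"
  unfolding cell_act_def using cell_subset_verts act_one by (force simp: image_iff)

lemma cell_orbit_self: "subgroup H G \<Longrightarrow> x \<in> X \<Longrightarrow> x \<in> cell_orbit act H x"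
  unfolding cell_orbit_def using cell_act_one subgroup.one_closed by force

lemma cell_orbit_eq:
  assumes H: "subgroup H G" and x: "x \<in> X" and y: "y \<in> cell_orbit act H x"
  shows "cell_orbit act H y = cell_orbit act H x"
proof -
  obtain h where h: "h \<in> H" "y = cell_act act h x" using y by (auto simp: cell_orbit_def)
  note hG = subgroup.mem_carrier[OF H]
  have 1: "cell_act act k y = cell_act act (k \<otimes> h) x" if "k \<in> H" for k
    using h hG that x by (simp add: cell_act_mult)
  have 2: "cell_act act k x = cell_act act (k \<otimes> inv h) y" if "k \<in> H" for k
  proof -
    have "(k \<otimes> inv h) \<otimes> h = k" using hG h(1) that by (simp add: m_assoc)
    thus ?thesis using h hG that x by (simp flip: cell_act_mult)
  qed
  show ?thesis
  proof (intro equalityI subsetI)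
    fix z assume "z \<in> cell_orbit act H y"
    thus "z \<in> cell_orbit act H x"
      using 1 subgroup.m_closed[OF H _ h(1)] by (auto simp: cell_orbit_def)
  next
    fix z assume "z \<in> cell_orbit act H x"
    thus "z \<in> cell_orbit act H y"
      using 2 subgroup.m_closed[OF H _ subgroup.m_inv_closed[OF H h(1)]]
      by (auto simp: cell_orbit_def)
  qed
qed

lemma cell_orbit_one: "x \<in> X \<Longrightarrow> cell_orbit act {\<one>} x = {x}"
  by (auto simp: cell_orbit_def cell_act_one)

lemma objX_eq: "X0 = {{x} | x. x \<in> X}"
  unfolding objX_def quot_def using cell_orbit_one by auto

lemma objX_E:
  assumes "c \<in> X0" obtains x where "x \<in> X" "c = {x}"
  using assms by (auto simp: objX_eq)

lemma empty_notin_quot: "subgroup H G \<Longrightarrow> {} \<notin> quot act H X"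
  unfolding quot_def using cell_orbit_self by blast

text \<open>Distinct orbits are disjoint, and a nonempty \<open>c\<close> contains a cell whose
  translate lies in exactly one of them; hence the definite description in \<open>mor\<close> is
  met.\<close>

lemma mor_quot_eqI:
  assumes H: "subgroup H G" and x: "x \<in> X" and c: "c \<in> Y" "c \<noteq> {}"
    and sub: "cell_act act g ` c \<subseteq> cell_orbit act H x"
  shows "mor act Y (quot act H X) g c = cell_orbit act H x"
proof -
  have "(THE z. z \<in> quot act H X \<and> cell_act act g ` c \<subseteq> z) = cell_orbit act H x"
  proof (rule the_equality)
    show "cell_orbit act H x \<in> quot act H X \<and> cell_act act g ` c \<subseteq> cell_orbit act H x"
      using x sub by (auto simp: quot_def)
  next
    fix z assume z: "z \<in> quot act H X \<and> cell_act act g ` c \<subseteq> z"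
    obtain c' where "c' \<in> c" using c by blast
    moreover obtain x' where "x' \<in> X" "z = cell_orbit act H x'" using z by (auto simp: quot_def)
    ultimately show "z = cell_orbit act H x"
      using z sub cell_orbit_eq[OF H x, of "cell_act act g c'"]
        cell_orbit_eq[OF H, of x' "cell_act act g c'"] by (auto simp: image_subset_iff)
  qed
  thus ?thesis using c by (simp add: mor_def)
qed

lemma mor_X:
  assumes H: "subgroup H G" and x: "x \<in> X" "g \<in> carrier G"
  shows "mor act X0 (quot act H X) g {x} = cell_orbit act H (cell_act act g x)"
  using x cell_act_closed cell_orbit_self[OF H] by (intro mor_quot_eqI[OF H]) (auto simp: objX_eq)

lemma mor_quot_one:
  assumes H': "subgroup H' G" and H: "subgroup H G" and sub: "H' \<subseteq> H" and x: "x \<in> X"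
  shows "mor act (quot act H' X) (quot act H X) \<one> (cell_orbit act H' x) = cell_orbit act H x"
proof (rule mor_quot_eqI[OF H x])
  show "cell_orbit act H' x \<in> quot act H' X" "cell_orbit act H' x \<noteq> {}"
    using x cell_orbit_self[OF H' x] by (auto simp: quot_def)
  have "cell_orbit act H' x \<subseteq> X"
    using x subgroup.mem_carrier[OF H'] by (auto simp: cell_orbit_def intro: cell_act_closed)
  hence "cell_act act \<one> ` cell_orbit act H' x = cell_orbit act H' x"
    using cell_act_one by force
  thus "cell_act act \<one> ` cell_orbit act H' x \<subseteq> cell_orbit act H x"
    using sub by (auto simp: cell_orbit_def)
qed

lemma mor_X_X: "x \<in> X \<Longrightarrow> g \<in> carrier G \<Longrightarrow> mor act X0 X0 g {x} = {cell_act act g x}"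
  using mor_X[OF triv_subgroup, of x g] cell_orbit_one cell_act_closed by (simp flip: objX_def)

lemma mor_comp_X:
  assumes H: "subgroup H G" and g: "g \<in> carrier G" "h \<in> carrier G"
  shows "mor act X0 (quot act H X) g \<circ> mor act X0 X0 h = mor act X0 (quot act H X) (g \<otimes> h)"
proof
  fix c
  show "(mor act X0 (quot act H X) g \<circ> mor act X0 X0 h) c = mor act X0 (quot act H X) (g \<otimes> h) c"
  proof (cases "c \<in> X0")
    case True
    then obtain x where "x \<in> X" "c = {x}" by (rule objX_E)
    thus ?thesis using g H by (simp add: mor_X mor_X_X cell_act_closed cell_act_mult)
  next
    case False
    \<comment> \<open>Equality of morphisms is equality of functions, also outside the source. There
      the inner map returns \<open>{}\<close>, which is no orbit, so the outer map returns
      \<open>{}\<close> as well.\<close>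
    moreover have "{} \<notin> X0" using objX_eq by auto
    ultimately show ?thesis by (simp add: mor_def)
  qed
qed

lemma mor_comp_quot:
  assumes H': "subgroup H' G" and H: "subgroup H G" and sub: "H' \<subseteq> H"
  shows "mor act (quot act H' X) (quot act H X) \<one> \<circ> mor act X0 (quot act H' X) \<one> =
    mor act X0 (quot act H X) \<one>"
proof
  fix c
  show "(mor act (quot act H' X) (quot act H X) \<one> \<circ> mor act X0 (quot act H' X) \<one>) c =
    mor act X0 (quot act H X) \<one> c"
  proof (cases "c \<in> X0")
    case True
    then obtain x where "x \<in> X" "c = {x}" by (rule objX_E)
    thus ?thesis using assms by (simp add: mor_X mor_quot_one cell_act_one)
  next
    case False
    thus ?thesis using empty_notin_quot[OF H'] by (simp add: mor_def)
  qed
qed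

lemma mor_X_absorb:
  assumes H: "subgroup H G" and h: "h \<in> H"
  shows "mor act X0 (quot act H X) h = mor act X0 (quot act H X) \<one>"
proof
  fix c
  show "mor act X0 (quot act H X) h c = mor act X0 (quot act H X) \<one> c"
  proof (cases "c \<in> X0")
    case True
    then obtain x where x: "x \<in> X" "c = {x}" by (rule objX_E)
    have "cell_act act h x \<in> cell_orbit act H x" using h by (auto simp: cell_orbit_def)
    thus ?thesis using x H h cell_orbit_eq[OF H x(1)] subgroup.mem_carrier[OF H h]
      by (simp add: mor_X cell_act_one)
  qed (simp add: mor_def)
qed

lemma X0_in_objs: "X0 \<in> Ob"
  by (simp add: objs_def)

text \<open>\<open>objs\<close> adjoins \<open>X0\<close> on its own; pairing it with the trivial
  subgroup lets the orbit computations treat all objects alike.\<close>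

lemma objs_quot:
  assumes "Y \<in> Ob"
  obtains H where "subgroup H G" "Y = quot act H X" "Y = X0 \<and> H = {\<one>} \<or> le_X G act X H"
  using assms triv_subgroup by (auto simp: objs_def objX_def le_X_def)

lemma mor_in_homs: "Y \<in> Ob \<Longrightarrow> g \<in> carrier G \<Longrightarrow> mor act X0 Y g \<in> homs G act X X0 Y"
  unfolding homs_def by (simp add: X0_in_objs) blast

text \<open>A cover map is injective on closed cells and on vertex stars, so the fixed vertices of a
  deck transformation form a union of connected components.\<close>

lemma le_X_free:
  assumes H: "le_X G act X H" and h: "h \<in> H" and c: "c \<in> X" "c \<noteq> {}"
    and fix_c: "cell_act act h c = c"
  shows "h = \<one>"
proof -
  have sub: "subgroup H G" using H by (simp add: le_X_def)
  obtain K :: "'v set set set set" and \<phi> f where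
    "cover_map X K f \<and> (\<forall>x\<in>X. f ` x = \<phi> (cell_orbit act H x))"
    using H unfolding le_X_def by (elim conjE exE) (rule that, rule conjI)
  hence cov: "cover_map X K f" and f: "\<And>x. x \<in> X \<Longrightarrow> f ` x = \<phi> (cell_orbit act H x)" by simp_all
  have hG: "h \<in> carrier G" using subgroup.mem_carrier[OF sub h] .
  \<comment> \<open>Since \<open>f\<close> factors through orbits, \<open>h\<close> acts as a deck
    transformation of the cover.\<close>
  have inv: "f ` cell_act act h x = f ` x" if "x \<in> X" for x
  proof -
    have "cell_act act h x \<in> cell_orbit act H x" using h by (auto simp: cell_orbit_def)
    thus ?thesis using that cell_orbit_eq[OF sub that] f hG by (simp add: cell_act_closed)
  qed
  have closed: "x \<in> X \<Longrightarrow> y \<subseteq> x \<Longrightarrow> y \<in> X" and fin: "x \<in> X \<Longrightarrow> finite x" for x y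
    using simplicial by (auto simp: simplicial_complex_def)
  obtain v where v: "v \<in> c" using c by blast
  have "act h v \<in> c" using v fix_c by (auto simp: cell_act_def)
  moreover have "f (act h v) = f v"
    using inv[of "{v}"] closed[OF c(1)] v by (simp add: cell_act_def)
  moreover have "inj_on f c"
    using cov c(1) fin by (simp add: cover_map_def eq_card_imp_inj_on)
  ultimately have v_fix: "act h v = v" using v by (auto dest: inj_onD)
  have v_vert: "v \<in> verts X" using v c cell_subset_verts by blast
  have fixed: "act h w = w" if "(v, w) \<in> {(a, b). {a, b} \<in> X}\<^sup>*" for w
    using that
  proof (induction rule: rtrancl_induct)
    case (step a b)
    hence ab: "{a, b} \<in> X" and a: "act h a = a" by auto
    have "a \<in> verts X" using closed[OF ab, of "{a}"] by (simp add: verts_def)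
    hence "inj_on ((`) f) {x \<in> X. a \<in> x}"
      using cov by (auto simp: cover_map_def bij_betw_def)
    moreover have "cell_act act h {a, b} \<in> X" "a \<in> cell_act act h {a, b}"
      using cell_act_closed[OF hG ab] a by (auto simp: cell_act_def)
    ultimately have "cell_act act h {a, b} = {a, b}"
      using inv[OF ab] ab by (intro inj_onD[where f = "(`) f" and A = "{x \<in> X. a \<in> x}"]) simp_all
    thus ?case using a by (auto simp: cell_act_def doubleton_eq_iff)
  qed (rule v_fix)
  have "act h w = w" if "w \<in> verts X" for w
    using fixed simplicial v_vert that by (simp add: simplicial_complex_def sc_connected_def)
  thus ?thesis using hG by (intro act_faithful)
qed

section \<open>Functors on the category of quotients\<close>

text \<open>Forgetting the linear structure lets the functor lemmas below serve both F and
  S.\<close>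

lemma phil_functor_set_functor:
  assumes "phil_functor G act X Fob Fmor"
  shows "set_functor G act X (\<lambda>Y. pcarrier (Fob Y)) Fmor"
  using assms unfolding phil_functor_def set_functor_def
  by - (elim conjE, intro conjI, simp add: lin_map_def, assumption+)

definition proj :: "('v obj \<Rightarrow> 'v obj \<Rightarrow> 'v mor \<Rightarrow> 's \<Rightarrow> 's) \<Rightarrow> 'v obj \<Rightarrow> 's \<Rightarrow> 's" where
  "proj Smor Y = Smor X0 Y (mor act X0 Y \<one>)"

abbreviation "gact \<equiv> S_act act X0"

context
  fixes S :: "'v obj \<Rightarrow> 's set" and Smor
  assumes S: "set_functor G act X S Smor"
begin

lemma functor_closed: "Y \<in> Ob \<Longrightarrow> Z \<in> Ob \<Longrightarrow> m \<in> homs G act X Y Z \<Longrightarrow> x \<in> S Y \<Longrightarrow> Smor Y Z m x \<in> S Z"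
  by (rule S[unfolded set_functor_def, THEN conjunct1, rule_format])

lemma functor_id: "Y \<in> Ob \<Longrightarrow> m \<in> homs G act X Y Y \<Longrightarrow> (\<And>c. c \<in> Y \<Longrightarrow> m c = c) \<Longrightarrow> x \<in> S Y \<Longrightarrow>
    Smor Y Y m x = x"
  by (rule S[unfolded set_functor_def, THEN conjunct2, THEN conjunct1, rule_format])

lemma functor_comp: "Y \<in> Ob \<Longrightarrow> Z \<in> Ob \<Longrightarrow> W \<in> Ob \<Longrightarrow> m \<in> homs G act X Y Z \<Longrightarrow>
    n \<in> homs G act X Z W \<Longrightarrow> x \<in> S Y \<Longrightarrow> Smor Y W (n \<circ> m) x = Smor Z W n (Smor Y Z m x)"
  by (rule S[unfolded set_functor_def, THEN conjunct2, THEN conjunct2, rule_format])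

lemma gact_closed: "g \<in> carrier G \<Longrightarrow> x \<in> S X0 \<Longrightarrow> gact Smor g x \<in> S X0"
  unfolding S_act_def by (intro functor_closed X0_in_objs mor_in_homs)

lemma proj_closed: "Y \<in> Ob \<Longrightarrow> x \<in> S X0 \<Longrightarrow> proj Smor Y x \<in> S Y"
  unfolding proj_def by (intro functor_closed X0_in_objs mor_in_homs one_closed)

lemma gact_one: "x \<in> S X0 \<Longrightarrow> gact Smor \<one> x = x"
  unfolding S_act_def
  by (intro functor_id X0_in_objs mor_in_homs one_closed) (auto elim!: objX_E simp: mor_X_X cell_act_one)

lemma mor_X_functor:
  assumes Y: "Y \<in> Ob" and g: "g \<in> carrier G" "h \<in> carrier G" and x: "x \<in> S X0"
  shows "Smor X0 Y (mor act X0 Y (g \<otimes> h)) x = Smor X0 Y (mor act X0 Y g) (gact Smor h x)"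
proof -
  obtain H where H: "subgroup H G" "Y = quot act H X" using objs_quot[OF Y] by metis
  have "mor act X0 Y (g \<otimes> h) = mor act X0 Y g \<circ> mor act X0 X0 h"
    using mor_comp_X[OF H(1)] g H(2) by simp
  thus ?thesis unfolding S_act_def
    using functor_comp[OF X0_in_objs X0_in_objs Y] g x mor_in_homs Y X0_in_objs by simp
qed

lemma gact_mult: "g \<in> carrier G \<Longrightarrow> h \<in> carrier G \<Longrightarrow> x \<in> S X0 \<Longrightarrow>
    gact Smor (g \<otimes> h) x = gact Smor g (gact Smor h x)"
  using mor_X_functor[OF X0_in_objs] by (simp add: S_act_def)

lemma gact_inv: "g \<in> carrier G \<Longrightarrow> x \<in> S X0 \<Longrightarrow> gact Smor (inv g) (gact Smor g x) = x"
  and gact_inv': "g \<in> carrier G \<Longrightarrow> x \<in> S X0 \<Longrightarrow> gact Smor g (gact Smor (inv g) x) = x"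
  by (simp_all flip: gact_mult add: gact_one)

text \<open>Every morphism out of X is a projection after a group element, so naturality there
  splits into equivariance and compatibility with \<open>proj\<close>.\<close>

lemma mor_X_proj: "Y \<in> Ob \<Longrightarrow> g \<in> carrier G \<Longrightarrow> x \<in> S X0 \<Longrightarrow>
    Smor X0 Y (mor act X0 Y g) x = proj Smor Y (gact Smor g x)"
  using mor_X_functor[of Y \<one> g x] by (simp add: proj_def)

lemma proj_gact: "Y \<in> Ob \<Longrightarrow> subgroup H G \<Longrightarrow> Y = quot act H X \<Longrightarrow> h \<in> H \<Longrightarrow> x \<in> S X0 \<Longrightarrow>
    proj Smor Y (gact Smor h x) = proj Smor Y x"
  using mor_X_proj[of Y h x] mor_X_absorb[of H h] subgroup.mem_carrier[of H G h]
  by (simp add: proj_def)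

text \<open>The remaining morphisms: out of a proper quotient there is only the canonical map, and
  composing it with the projection from X gives the projection to the smaller quotient.\<close>

lemma mor_proj:
  assumes Y: "Y \<in> Ob" "Z \<in> Ob" "Y \<noteq> X0" and m: "m \<in> homs G act X Y Z" and x: "x \<in> S X0"
  shows "Smor Y Z m (proj Smor Y x) = proj Smor Z x"
proof -
  obtain H' H where H: "H' \<subseteq> H" "le_X G act X H'" "le_X G act X H" "Y = quot act H' X"
    "Z = quot act H X" "m = mor act Y Z \<one>"
    using m Y by (auto simp: homs_def)
  have "m \<circ> mor act X0 Y \<one> = mor act X0 Z \<one>"
    using mor_comp_quot[of H' H] H by (auto simp: le_X_def)
  thus ?thesis unfolding proj_def
    using functor_comp[OF X0_in_objs Y(1,2) mor_in_homs[OF Y(1) one_closed] m x] by simp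
qed

end

end

section \<open>Natural transformations and the algebra of operators\<close>

context G_complex_setting
begin

lemma natural_lin_map: "natural G act X Fob Fmor a \<Longrightarrow> Y \<in> Ob \<Longrightarrow> lin_map (Fob Y) (Fob Y) (a Y)"
  and natural_outside: "natural G act X Fob Fmor a \<Longrightarrow> Y \<in> Ob \<Longrightarrow> u \<notin> pcarrier (Fob Y) \<Longrightarrow>
    a Y u = pzero (Fob Y)"
  and natural_undefined: "natural G act X Fob Fmor a \<Longrightarrow> Y \<notin> Ob \<Longrightarrow> a Y = undefined"
  and natural_commute: "natural G act X Fob Fmor a \<Longrightarrow> Y \<in> Ob \<Longrightarrow> Z \<in> Ob \<Longrightarrow>
    m \<in> homs G act X Y Z \<Longrightarrow> u \<in> pcarrier (Fob Y) \<Longrightarrow> a Z (Fmor Y Z m u) = Fmor Y Z m (a Y u)"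
  by (simp_all add: natural_def op_family_def)

lemma naturalI:
  assumes "\<And>Y. Y \<notin> Ob \<Longrightarrow> a Y = undefined"
    and "\<And>Y. Y \<in> Ob \<Longrightarrow> lin_map (Fob Y) (Fob Y) (a Y)"
    and "\<And>Y u. Y \<in> Ob \<Longrightarrow> u \<notin> pcarrier (Fob Y) \<Longrightarrow> a Y u = pzero (Fob Y)"
    and "\<And>Y Z m u. Y \<in> Ob \<Longrightarrow> Z \<in> Ob \<Longrightarrow> m \<in> homs G act X Y Z \<Longrightarrow> u \<in> pcarrier (Fob Y) \<Longrightarrow>
      a Z (Fmor Y Z m u) = Fmor Y Z m (a Y u)"
  shows "natural G act X Fob Fmor a"
  unfolding natural_def op_family_def using assms by simp

lemma natural_closed:
  "natural G act X Fob Fmor a \<Longrightarrow> Y \<in> Ob \<Longrightarrow> u \<in> pcarrier (Fob Y) \<Longrightarrow> a Y u \<in> pcarrier (Fob Y)"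
  by (rule lin_map_closed[OF natural_lin_map])

lemma CF_operatorsI:
  "natural G act X Fob Fmor a \<Longrightarrow> natural G act X Fob Fmor b \<Longrightarrow>
    (\<And>Y. Y \<in> Ob \<Longrightarrow> is_adjoint (Fob Y) (b Y) (a Y)) \<Longrightarrow> a \<in> CF_operators G act X Fob Fmor"
  by (auto simp: CF_operators_def)

lemma CF_operatorsE:
  assumes "a \<in> CF_operators G act X Fob Fmor"
  obtains b where "natural G act X Fob Fmor a" "natural G act X Fob Fmor b"
    "\<And>Y. Y \<in> Ob \<Longrightarrow> is_adjoint (Fob Y) (b Y) (a Y)"
  using assms by (auto simp: CF_operators_def)

context
  fixes Fob :: "'v obj \<Rightarrow> 'h phil" and Fmor
  assumes F: "phil_functor G act X Fob Fmor"
begin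

lemma pre_hilbert_Fob: "Y \<in> Ob \<Longrightarrow> pre_hilbert (Fob Y)"
  and lin_map_Fmor: "Y \<in> Ob \<Longrightarrow> Z \<in> Ob \<Longrightarrow> m \<in> homs G act X Y Z \<Longrightarrow>
    lin_map (Fob Y) (Fob Z) (Fmor Y Z m)"
  using F by (simp_all add: phil_functor_def)

lemma natural_zero:
  "natural G act X Fob Fmor a \<Longrightarrow> Y \<in> Ob \<Longrightarrow> a Y (pzero (Fob Y)) = pzero (Fob Y)"
  by (rule lin_map_zero[OF pre_hilbert_Fob pre_hilbert_Fob natural_lin_map])

lemma natural_add:
  assumes a: "natural G act X Fob Fmor a" and b: "natural G act X Fob Fmor b"
  shows "natural G act X Fob Fmor (op_add Ob Fob a b)"
proof (rule naturalI)
  fix Y assume Y: "Y \<in> Ob"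
  interpret V: pre_hilbert_space "Fob Y" by unfold_locales (rule pre_hilbert_Fob[OF Y])
  show "lin_map (Fob Y) (Fob Y) (op_add Ob Fob a b Y)"
    using Y V.lin_map_sum[OF natural_lin_map[OF a Y] natural_lin_map[OF b Y]] by (simp add: op_add_def)
  show "op_add Ob Fob a b Y u = pzero (Fob Y)" if "u \<notin> pcarrier (Fob Y)" for u
    using that Y natural_outside[OF a Y] natural_outside[OF b Y]
    by (simp add: op_add_def V.add_zero V.zero_closed)
next
  fix Y Z m u assume *: "Y \<in> Ob" "Z \<in> Ob" "m \<in> homs G act X Y Z" "u \<in> pcarrier (Fob Y)"
  thus "op_add Ob Fob a b Z (Fmor Y Z m u) = Fmor Y Z m (op_add Ob Fob a b Y u)"
    by (simp add: op_add_def natural_commute[OF a] natural_commute[OF b]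
        lin_map_add[OF lin_map_Fmor] natural_closed[OF a] natural_closed[OF b])
qed (simp add: op_add_def)

lemma natural_scale:
  assumes a: "natural G act X Fob Fmor a"
  shows "natural G act X Fob Fmor (op_scale Ob Fob c a)"
proof (rule naturalI)
  fix Y assume Y: "Y \<in> Ob"
  interpret V: pre_hilbert_space "Fob Y" by unfold_locales (rule pre_hilbert_Fob[OF Y])
  show "lin_map (Fob Y) (Fob Y) (op_scale Ob Fob c a Y)"
    using Y V.lin_map_multiple[OF natural_lin_map[OF a Y]] by (simp add: op_scale_def)
  show "op_scale Ob Fob c a Y u = pzero (Fob Y)" if "u \<notin> pcarrier (Fob Y)" for u
    using that Y natural_outside[OF a Y] by (simp add: op_scale_def V.scale_zero_right)
next
  fix Y Z m u assume *: "Y \<in> Ob" "Z \<in> Ob" "m \<in> homs G act X Y Z" "u \<in> pcarrier (Fob Y)"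
  thus "op_scale Ob Fob c a Z (Fmor Y Z m u) = Fmor Y Z m (op_scale Ob Fob c a Y u)"
    by (simp add: op_scale_def natural_commute[OF a] lin_map_scale[OF lin_map_Fmor] natural_closed[OF a])
qed (simp add: op_scale_def)

lemma natural_comp:
  assumes a: "natural G act X Fob Fmor a" and b: "natural G act X Fob Fmor b"
  shows "natural G act X Fob Fmor (op_comp Ob a b)"
proof (rule naturalI)
  fix Y assume Y: "Y \<in> Ob"
  show "lin_map (Fob Y) (Fob Y) (op_comp Ob a b Y)"
    using Y lin_map_comp[OF natural_lin_map[OF b Y] natural_lin_map[OF a Y]]
    by (simp add: op_comp_def comp_def)
  show "op_comp Ob a b Y u = pzero (Fob Y)" if "u \<notin> pcarrier (Fob Y)" for u
    using that Y natural_outside[OF b Y] natural_zero[OF a Y] by (simp add: op_comp_def)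
next
  fix Y Z m u assume *: "Y \<in> Ob" "Z \<in> Ob" "m \<in> homs G act X Y Z" "u \<in> pcarrier (Fob Y)"
  thus "op_comp Ob a b Z (Fmor Y Z m u) = Fmor Y Z m (op_comp Ob a b Y u)"
    by (simp add: op_comp_def natural_commute[OF a] natural_commute[OF b] natural_closed[OF b])
qed (simp add: op_comp_def)

text \<open>The adjoint family is itself an operator, because the original family is its adjoint in
  turn.\<close>

lemma CF_operators_adjoint:
  assumes "a \<in> CF_operators G act X Fob Fmor"
  shows "\<exists>b \<in> CF_operators G act X Fob Fmor. \<forall>Y \<in> Ob. is_adjoint (Fob Y) (b Y) (a Y)"
proof -
  obtain b where a: "natural G act X Fob Fmor a" and b: "natural G act X Fob Fmor b"
    and ab: "\<And>Y. Y \<in> Ob \<Longrightarrow> is_adjoint (Fob Y) (b Y) (a Y)"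
    using CF_operatorsE[OF assms] by metis
  have "is_adjoint (Fob Y) (a Y) (b Y)" if Y: "Y \<in> Ob" for Y
    using pre_hilbert_space.adjoint_swap[OF pre_hilbert_space.intro[OF pre_hilbert_Fob[OF Y]] ab[OF Y]]
      natural_closed[OF a Y] natural_closed[OF b Y] by simp
  hence "b \<in> CF_operators G act X Fob Fmor" by (rule CF_operatorsI[OF b a])
  thus ?thesis using ab by auto
qed

lemma CF_operators_add:
  assumes "a \<in> CF_operators G act X Fob Fmor" "b \<in> CF_operators G act X Fob Fmor"
  shows "op_add Ob Fob a b \<in> CF_operators G act X Fob Fmor"
proof -
  obtain a' where a: "natural G act X Fob Fmor a" "natural G act X Fob Fmor a'"
    "\<And>Y. Y \<in> Ob \<Longrightarrow> is_adjoint (Fob Y) (a' Y) (a Y)"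
    using CF_operatorsE[OF assms(1)] by metis
  obtain b' where b: "natural G act X Fob Fmor b" "natural G act X Fob Fmor b'"
    "\<And>Y. Y \<in> Ob \<Longrightarrow> is_adjoint (Fob Y) (b' Y) (b Y)"
    using CF_operatorsE[OF assms(2)] by metis
  show ?thesis
  proof (rule CF_operatorsI[OF natural_add[OF a(1) b(1)] natural_add[OF a(2) b(2)]])
    fix Y assume Y: "Y \<in> Ob"
    interpret V: pre_hilbert_space "Fob Y" by unfold_locales (rule pre_hilbert_Fob[OF Y])
    show "is_adjoint (Fob Y) (op_add Ob Fob a' b' Y) (op_add Ob Fob a b Y)"
      using Y a(3)[OF Y] b(3)[OF Y] a(1,2)[THEN natural_closed] b(1,2)[THEN natural_closed]
      by (simp add: is_adjoint_def op_add_def V.inner_add_left V.inner_add_right)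
  qed
qed

lemma CF_operators_scale:
  assumes "a \<in> CF_operators G act X Fob Fmor"
  shows "op_scale Ob Fob c a \<in> CF_operators G act X Fob Fmor"
proof -
  obtain a' where a: "natural G act X Fob Fmor a" "natural G act X Fob Fmor a'"
    "\<And>Y. Y \<in> Ob \<Longrightarrow> is_adjoint (Fob Y) (a' Y) (a Y)"
    using CF_operatorsE[OF assms] by metis
  show ?thesis
  proof (rule CF_operatorsI[OF natural_scale[OF a(1)] natural_scale[OF a(2), of "cnj c"]])
    fix Y assume Y: "Y \<in> Ob"
    interpret V: pre_hilbert_space "Fob Y" by unfold_locales (rule pre_hilbert_Fob[OF Y])
    show "is_adjoint (Fob Y) (op_scale Ob Fob (cnj c) a' Y) (op_scale Ob Fob c a Y)"
      using Y a(3)[OF Y] a(1,2)[THEN natural_closed]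
      by (simp add: is_adjoint_def op_scale_def V.inner_scale_left V.inner_scale_right)
  qed
qed

lemma CF_operators_comp:
  assumes "a \<in> CF_operators G act X Fob Fmor" "b \<in> CF_operators G act X Fob Fmor"
  shows "op_comp Ob a b \<in> CF_operators G act X Fob Fmor"
proof -
  obtain a' where a: "natural G act X Fob Fmor a" "natural G act X Fob Fmor a'"
    "\<And>Y. Y \<in> Ob \<Longrightarrow> is_adjoint (Fob Y) (a' Y) (a Y)"
    using CF_operatorsE[OF assms(1)] by metis
  obtain b' where b: "natural G act X Fob Fmor b" "natural G act X Fob Fmor b'"
    "\<And>Y. Y \<in> Ob \<Longrightarrow> is_adjoint (Fob Y) (b' Y) (b Y)"
    using CF_operatorsE[OF assms(2)] by metis
  show ?thesis
  proof (rule CF_operatorsI[OF natural_comp[OF a(1) b(1)] natural_comp[OF b(2) a(2)]])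
    fix Y assume Y: "Y \<in> Ob"
    show "is_adjoint (Fob Y) (op_comp Ob b' a' Y) (op_comp Ob a b Y)"
      using Y a(3)[OF Y] b(3)[OF Y] a(1,2)[THEN natural_closed] b(1,2)[THEN natural_closed]
      by (simp add: is_adjoint_def op_comp_def)
  qed
qed

lemma lin_map_proj: "Y \<in> Ob \<Longrightarrow> lin_map (Fob X0) (Fob Y) (proj Fmor Y)"
  unfolding proj_def[abs_def] by (intro lin_map_Fmor X0_in_objs mor_in_homs one_closed)

end

end

section \<open>Functors that are orthogonal retracts of finitely supported functions\<close>

text \<open>The form in which semi-elementarity is used. \<open>ret_emb\<close> and
  \<open>inner_emb\<close> make \<open>emb\<close> an isometry with adjoint \<open>ret\<close>, both
  natural: the inclusion of a summand and the orthogonal projection onto it. The assumptions on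
  stabilizers, orbits and quotients are (E2) to (E4) written with \<open>gact\<close> and
  \<open>proj\<close>.\<close>

locale l2_retract = G_complex_setting G T act X
  for G :: "('g, 'm) monoid_scheme" (structure) and T :: "'g topology"
    and act :: "'g \<Rightarrow> 'v \<Rightarrow> 'v" and X :: "'v set set" +
  fixes Fob :: "'v obj \<Rightarrow> 'h phil" and Fmor :: "'v obj \<Rightarrow> 'v obj \<Rightarrow> 'v mor \<Rightarrow> 'h \<Rightarrow> 'h"
    and S :: "'v obj \<Rightarrow> 's set" and Smor :: "'v obj \<Rightarrow> 'v obj \<Rightarrow> 'v mor \<Rightarrow> 's \<Rightarrow> 's"
    and emb :: "'v obj \<Rightarrow> 'h \<Rightarrow> 's \<Rightarrow> complex" and ret :: "'v obj \<Rightarrow> ('s \<Rightarrow> complex) \<Rightarrow> 'h"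
  assumes F: "phil_functor G act X Fob Fmor" and S: "set_functor G act X S Smor"
    and stab_compact: "x \<in> S X0 \<Longrightarrow> compactin T {g \<in> carrier G. gact Smor g x = x}"
    and stab_open: "x \<in> S X0 \<Longrightarrow> openin T {g \<in> carrier G. gact Smor g x = x}"
    and stab_cell: "x \<in> S X0 \<Longrightarrow>
      \<exists>c \<in> X. c \<noteq> {} \<and> {g \<in> carrier G. gact Smor g x = x} \<subseteq> cell_stab G act c"
    and quotient_bij: "le_X G act X H \<Longrightarrow>
      bij_betw (\<lambda>c. the_elem (proj Smor (quot act H X) ` c))
        {{gact Smor h x | h. h \<in> H} | x. x \<in> S X0} (S (quot act H X))"
    and finite_orbits: "finite {{gact Smor g x | g. g \<in> carrier G} | x. x \<in> S X0}"
    and lin_map_emb: "Y \<in> Ob \<Longrightarrow> lin_map (Fob Y) (l2t (S Y)) (emb Y)"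
    and lin_map_ret: "Y \<in> Ob \<Longrightarrow> lin_map (l2t (S Y)) (Fob Y) (ret Y)"
    and ret_emb: "Y \<in> Ob \<Longrightarrow> u \<in> pcarrier (Fob Y) \<Longrightarrow> ret Y (emb Y u) = u"
    and inner_emb: "Y \<in> Ob \<Longrightarrow> u \<in> pcarrier (Fob Y) \<Longrightarrow> \<phi> \<in> pcarrier (l2t (S Y)) \<Longrightarrow>
      pinner (l2t (S Y)) (emb Y u) \<phi> = pinner (Fob Y) u (ret Y \<phi>)"
    and emb_natural: "Y \<in> Ob \<Longrightarrow> Z \<in> Ob \<Longrightarrow> m \<in> homs G act X Y Z \<Longrightarrow> u \<in> pcarrier (Fob Y) \<Longrightarrow>
      emb Z (Fmor Y Z m u) = push (Smor Y Z m) (emb Y u)"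
    and ret_natural: "Y \<in> Ob \<Longrightarrow> Z \<in> Ob \<Longrightarrow> m \<in> homs G act X Y Z \<Longrightarrow>
      \<phi> \<in> pcarrier (l2t (S Y)) \<Longrightarrow> ret Z (push (Smor Y Z m) \<phi>) = Fmor Y Z m (ret Y \<phi>)"
begin

lemmas FS = phil_functor_set_functor[OF F]
lemmas F_gact_closed = gact_closed[OF FS, simplified]
lemmas F_proj_closed = proj_closed[OF FS, simplified]
lemmas emb_closed = lin_map_closed[OF lin_map_emb]
lemmas ret_closed = lin_map_closed[OF lin_map_ret]
lemmas pre_hilbert_space_Fob = pre_hilbert_space.intro[OF pre_hilbert_Fob[OF F]]

lemma proj_X0: "set_functor G act X S' Smor' \<Longrightarrow> x \<in> S' X0 \<Longrightarrow> proj Smor' X0 x = x"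
  using gact_one[of S' Smor' x] by (simp add: proj_def S_act_def)

lemma inner_emb_emb: "Y \<in> Ob \<Longrightarrow> u \<in> pcarrier (Fob Y) \<Longrightarrow> v \<in> pcarrier (Fob Y) \<Longrightarrow>
    pinner (l2t (S Y)) (emb Y u) (emb Y v) = pinner (Fob Y) u v"
  using inner_emb[OF _ _ emb_closed] by (simp add: ret_emb del: l2t_simps(1))

lemma emb_gact: "g \<in> carrier G \<Longrightarrow> u \<in> pcarrier (Fob X0) \<Longrightarrow>
    emb X0 (gact Fmor g u) = push (gact Smor g) (emb X0 u)"
  unfolding S_act_def by (intro emb_natural X0_in_objs mor_in_homs)

lemma emb_proj: "Y \<in> Ob \<Longrightarrow> u \<in> pcarrier (Fob X0) \<Longrightarrow>
    emb Y (proj Fmor Y u) = push (proj Smor Y) (emb X0 u)"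
  unfolding proj_def by (subst emb_natural) (simp_all add: X0_in_objs mor_in_homs proj_def[abs_def])

lemma ret_gact: "g \<in> carrier G \<Longrightarrow> \<phi> \<in> pcarrier (l2t (S X0)) \<Longrightarrow>
    ret X0 (push (gact Smor g) \<phi>) = gact Fmor g (ret X0 \<phi>)"
  unfolding S_act_def by (intro ret_natural X0_in_objs mor_in_homs)

lemma ret_proj: "Y \<in> Ob \<Longrightarrow> \<phi> \<in> pcarrier (l2t (S X0)) \<Longrightarrow>
    ret Y (push (proj Smor Y) \<phi>) = proj Fmor Y (ret X0 \<phi>)"
  using ret_natural[OF X0_in_objs, of Y "mor act X0 Y \<one>" \<phi>]
  by (simp add: mor_in_homs proj_def[abs_def])

lemma gact_cancel:
  assumes "h \<in> carrier G" "k \<in> carrier G" "x \<in> S X0" "gact Smor h x = gact Smor k x"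
  shows "gact Smor (inv k \<otimes> h) x = x"
  using assms gact_mult[OF S, of "inv k" h x] gact_inv[OF S, of k x] by simp

text \<open>(E3) identifies the fibres of \<open>proj\<close> with \<open>H\<close>-orbits. Freeness
  combines (E2) with \<open>le_X_free\<close>. The group is quantified inside the statement because
  an object does not carry its group.\<close>

lemma quotient_fibres:
  assumes Y: "Y \<in> Ob"
  shows "\<exists>H. subgroup H G \<and> proj Smor Y ` S X0 = S Y \<and>
    (\<forall>x\<in>S X0. \<forall>y\<in>S X0. proj Smor Y x = proj Smor Y y \<longleftrightarrow> (\<exists>h\<in>H. gact Smor h x = y)) \<and>
    (\<forall>x\<in>S X0. \<forall>h\<in>H. \<forall>k\<in>H. gact Smor h x = gact Smor k x \<longrightarrow> h = k)"
proof -
  obtain H where H: "subgroup H G" and YH: "Y = quot act H X"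
    and cases: "Y = X0 \<and> H = {\<one>} \<or> le_X G act X H"
    using objs_quot[OF Y] by metis
  show ?thesis
  proof (cases "le_X G act X H")
    case False
    with cases have "Y = X0" "H = {\<one>}" by simp_all
    thus ?thesis by (intro exI[of _ H] conjI H) (simp_all add: proj_X0[OF S] gact_one[OF S])
  next
    case True
    define orb where "orb x = {gact Smor h x | h. h \<in> H}" for x
    have orbits: "{{gact Smor h x | h. h \<in> H} | x. x \<in> S X0} = orb ` S X0"
      by (auto simp: orb_def)
    have invariant: "proj Smor Y (gact Smor h x) = proj Smor Y x" if "h \<in> H" "x \<in> S X0" for h x
      using proj_gact[OF S Y H YH] that by simp
    have self: "x \<in> orb x" if "x \<in> S X0" for x
      using gact_one[OF S that] subgroup.one_closed[OF H] unfolding orb_def by force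
    \<comment> \<open>The image of an orbit is a singleton, so \<open>the_elem\<close> in (E3) is
      evaluated to the common value.\<close>
    have proj_orb: "proj Smor Y ` orb x = {proj Smor Y x}" if "x \<in> S X0" for x
      using invariant that self[OF that] unfolding orb_def by auto
    have bij: "bij_betw (\<lambda>c. the_elem (proj Smor Y ` c)) (orb ` S X0) (S Y)"
      using quotient_bij[OF True] unfolding orbits YH .
    have surj: "proj Smor Y ` S X0 = S Y"
      using bij_betw_imp_surj_on[OF bij] by (simp add: image_image proj_orb)
    have fibre: "proj Smor Y x = proj Smor Y y \<longleftrightarrow> (\<exists>h\<in>H. gact Smor h x = y)"
      if x: "x \<in> S X0" and y: "y \<in> S X0" for x y
    proof
      assume eq: "proj Smor Y x = proj Smor Y y"
      have "orb x = orb y"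
        by (rule inj_onD[OF bij_betw_imp_inj_on[OF bij]]) (simp_all add: proj_orb x y eq)
      hence "y \<in> orb x" using self[OF y] by simp
      thus "\<exists>h\<in>H. gact Smor h x = y" by (auto simp: orb_def)
    qed (use invariant x in auto)
    have free: "h = k" if x: "x \<in> S X0" and h: "h \<in> H" and k: "k \<in> H"
      and eq: "gact Smor h x = gact Smor k x" for x h k
    proof -
      note hk = subgroup.mem_carrier[OF H h] subgroup.mem_carrier[OF H k]
      obtain c where c: "c \<in> X" "c \<noteq> {}" "{g \<in> carrier G. gact Smor g x = x} \<subseteq> cell_stab G act c"
        using stab_cell[OF x] by metis
      have "inv k \<otimes> h \<in> cell_stab G act c"
        using gact_cancel[OF hk x eq] hk c(3) by (simp add: subset_iff)
      hence "inv k \<otimes> h = \<one>"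
        using subgroup.m_closed[OF H subgroup.m_inv_closed[OF H k] h]
        by (intro le_X_free[OF True _ c(1,2)]) (simp_all add: cell_stab_def)
      hence "k \<otimes> (inv k \<otimes> h) = k" using hk by simp
      thus "h = k" using hk by (simp flip: m_assoc)
    qed
    show ?thesis by (intro exI[of _ H] conjI ballI impI H surj fibre free)
  qed
qed

text \<open>Embed \<open>v\<close> in functions on SY, lift along the surjection from SX, and apply
  \<open>ret\<close>; naturality of \<open>ret\<close> brings the result back to
  \<open>v\<close>.\<close>

lemma proj_surj:
  assumes Y: "Y \<in> Ob" and v: "v \<in> pcarrier (Fob Y)"
  obtains u where "u \<in> pcarrier (Fob X0)" "proj Fmor Y u = v"
proof -
  have "proj Smor Y ` S X0 = S Y" using quotient_fibres[OF Y] by (elim exE conjE)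
  then obtain \<phi> where \<phi>: "\<phi> \<in> pcarrier (l2t (S X0))" "push (proj Smor Y) \<phi> = emb Y v"
    using push_surj[OF _ emb_closed[OF Y v]] by metis
  show thesis
  proof (rule that)
    show "ret X0 \<phi> \<in> pcarrier (Fob X0)" by (rule ret_closed[OF X0_in_objs \<phi>(1)])
    show "proj Fmor Y (ret X0 \<phi>) = v"
      using ret_proj[OF Y \<phi>(1)] \<phi>(2) ret_emb[OF Y v] by simp
  qed
qed

text \<open>The sum over the possibly infinite group \<open>H\<close> has finitely many nonzero
  terms. It is stated for every finite \<open>C\<close> above some \<open>B\<close>, so that sums
  belonging to different pairs of vectors can share an index set.\<close>

lemma inner_proj:
  assumes Y: "Y \<in> Ob"
  shows "\<exists>H. subgroup H G \<and> (\<forall>u \<in> pcarrier (Fob X0). \<forall>v \<in> pcarrier (Fob X0).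
      \<exists>B. finite B \<and> B \<subseteq> H \<and> (\<forall>C. finite C \<longrightarrow> B \<subseteq> C \<longrightarrow> C \<subseteq> H \<longrightarrow>
        pinner (Fob Y) (proj Fmor Y u) (proj Fmor Y v) =
        (\<Sum>h\<in>C. pinner (Fob X0) (gact Fmor h u) v)))"
proof -
  obtain H where H: "subgroup H G" and
    "\<forall>x\<in>S X0. \<forall>y\<in>S X0. proj Smor Y x = proj Smor Y y \<longleftrightarrow> (\<exists>h\<in>H. gact Smor h x = y)" and
    "\<forall>x\<in>S X0. \<forall>h\<in>H. \<forall>k\<in>H. gact Smor h x = gact Smor k x \<longrightarrow> h = k"
    using quotient_fibres[OF Y] by (elim exE conjE) (rule that)
  note fibre = this(2)[rule_format] and free = this(3)[rule_format]
  show ?thesis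
  proof (rule exI[of _ H], intro conjI ballI H)
    fix u v assume u: "u \<in> pcarrier (Fob X0)" and v: "v \<in> pcarrier (Fob X0)"
    note eu = emb_closed[OF X0_in_objs u] and ev = emb_closed[OF X0_in_objs v]
    define B where "B = {h \<in> H. \<exists>x \<in> supp (emb X0 u). gact Smor h x \<in> supp (emb X0 v)}"
    \<comment> \<open>By freeness \<open>h\<close> is recovered from the point to which it moves
      \<open>x\<close>, and that point lies in a finite support.\<close>
    have "finite {h \<in> H. gact Smor h x \<in> supp (emb X0 v)}" if x: "x \<in> supp (emb X0 u)" for x
    proof (rule inj_on_finite)
      have "x \<in> S X0" using x eu by auto
      thus "inj_on (\<lambda>h. gact Smor h x) {h \<in> H. gact Smor h x \<in> supp (emb X0 v)}"
        by (intro inj_onI free) simp_all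
      show "finite (supp (emb X0 v))" using ev by simp
    qed auto
    hence "finite (\<Union>x \<in> supp (emb X0 u). {h \<in> H. gact Smor h x \<in> supp (emb X0 v)})"
      using eu by simp
    hence B: "finite B" "B \<subseteq> H"
      by (auto simp: B_def elim!: rev_finite_subset)
    have "pinner (Fob Y) (proj Fmor Y u) (proj Fmor Y v) =
        (\<Sum>h\<in>C. pinner (Fob X0) (gact Fmor h u) v)" if C: "finite C" "B \<subseteq> C" "C \<subseteq> H" for C
    proof -
      have "pinner (Fob Y) (proj Fmor Y u) (proj Fmor Y v) =
          pinner (l2t (S Y)) (push (proj Smor Y) (emb X0 u)) (push (proj Smor Y) (emb X0 v))"
        using inner_emb_emb[OF Y F_proj_closed[OF Y u] F_proj_closed[OF Y v]]
        by (simp add: emb_proj Y u v)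
      also have "\<dots> = (\<Sum>h\<in>C. pinner (l2t (S X0)) (push (gact Smor h) (emb X0 u)) (emb X0 v))"
        by (rule inner_push_free_quotient[OF eu ev fibre free C(1,3) C(2)[unfolded B_def]])
      also have "\<dots> = (\<Sum>h\<in>C. pinner (Fob X0) (gact Fmor h u) v)"
      proof (rule sum.cong[OF refl])
        fix h assume "h \<in> C"
        hence h: "h \<in> carrier G" using C(3) subgroup.subset[OF H] by blast
        show "pinner (l2t (S X0)) (push (gact Smor h) (emb X0 u)) (emb X0 v) =
            pinner (Fob X0) (gact Fmor h u) v"
          using inner_emb_emb[OF X0_in_objs F_gact_closed[OF h u] v] by (simp add: emb_gact h u)
      qed
      finally show ?thesis .
    qed
    thus "\<exists>B. finite B \<and> B \<subseteq> H \<and> (\<forall>C. finite C \<longrightarrow> B \<subseteq> C \<longrightarrow> C \<subseteq> H \<longrightarrow>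
        pinner (Fob Y) (proj Fmor Y u) (proj Fmor Y v) =
        (\<Sum>h\<in>C. pinner (Fob X0) (gact Fmor h u) v))"
      using B by blast
  qed
qed

abbreviation "EndG \<equiv> End_G G act X Fob Fmor"

lemma End_G_lin_map: "t \<in> EndG \<Longrightarrow> lin_map (Fob X0) (Fob X0) t"
  and End_G_outside: "t \<in> EndG \<Longrightarrow> u \<notin> pcarrier (Fob X0) \<Longrightarrow> t u = pzero (Fob X0)"
  and End_G_equivariant: "t \<in> EndG \<Longrightarrow> g \<in> carrier G \<Longrightarrow> u \<in> pcarrier (Fob X0) \<Longrightarrow>
    t (gact Fmor g u) = gact Fmor g (t u)"
  by (simp_all add: End_G_def Let_def S_act_def)

lemmas End_G_closed = lin_map_closed[OF End_G_lin_map]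

text \<open>Term by term: equivariance moves \<open>t\<close> past \<open>h\<close>, then the
  adjunction on FX moves it to the other side as \<open>s\<close>.\<close>

lemma inner_proj_adjoint:
  assumes Y: "Y \<in> Ob" and t: "t \<in> EndG" and s: "\<And>v. v \<in> pcarrier (Fob X0) \<Longrightarrow> s v \<in> pcarrier (Fob X0)"
    and adj: "is_adjoint (Fob X0) s t" and u: "u \<in> pcarrier (Fob X0)" and v: "v \<in> pcarrier (Fob X0)"
  shows "pinner (Fob Y) (proj Fmor Y (t u)) (proj Fmor Y v) =
    pinner (Fob Y) (proj Fmor Y u) (proj Fmor Y (s v))"
proof -
  obtain H where H: "subgroup H G" and "\<forall>u \<in> pcarrier (Fob X0). \<forall>v \<in> pcarrier (Fob X0).
      \<exists>B. finite B \<and> B \<subseteq> H \<and> (\<forall>C. finite C \<longrightarrow> B \<subseteq> C \<longrightarrow> C \<subseteq> H \<longrightarrow>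
        pinner (Fob Y) (proj Fmor Y u) (proj Fmor Y v) =
        (\<Sum>h\<in>C. pinner (Fob X0) (gact Fmor h u) v))"
    using inner_proj[OF Y] by (elim exE conjE) (rule that)
  note ip = this(2)[THEN bspec, THEN bspec]
  obtain B where B: "finite B" "B \<subseteq> H" and B': "\<And>C. finite C \<Longrightarrow> B \<subseteq> C \<Longrightarrow> C \<subseteq> H \<Longrightarrow>
      pinner (Fob Y) (proj Fmor Y (t u)) (proj Fmor Y v) =
      (\<Sum>h\<in>C. pinner (Fob X0) (gact Fmor h (t u)) v)"
    using ip[OF End_G_closed[OF t u] v] by metis
  obtain D where D: "finite D" "D \<subseteq> H" and D': "\<And>C. finite C \<Longrightarrow> D \<subseteq> C \<Longrightarrow> C \<subseteq> H \<Longrightarrow>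
      pinner (Fob Y) (proj Fmor Y u) (proj Fmor Y (s v)) =
      (\<Sum>h\<in>C. pinner (Fob X0) (gact Fmor h u) (s v))"
    using ip[OF u s[OF v]] by metis
  have "pinner (Fob X0) (gact Fmor h (t u)) v = pinner (Fob X0) (gact Fmor h u) (s v)"
    if "h \<in> B \<union> D" for h
  proof -
    have h: "h \<in> carrier G" using that B(2) D(2) subgroup.subset[OF H] by blast
    show ?thesis
      using adj F_gact_closed[OF h u] v
      by (simp add: is_adjoint_def End_G_equivariant[OF t h u, symmetric])
  qed
  thus ?thesis using B'[of "B \<union> D"] D'[of "B \<union> D"] B D by simp
qed

end

section \<open>Adjoints of equivariant endomorphisms\<close>

context l2_retract
begin

text \<open>Compact stabilizers against open ones: a compact set is covered by finitely many cosets.\<close>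

lemma stab_orbit_finite:
  assumes x: "x \<in> S X0" and y: "y \<in> S X0"
  shows "finite {gact Smor k x | k. k \<in> carrier G \<and> gact Smor k y = y}"
proof -
  define K where "K = {k \<in> carrier G. gact Smor k y = y}"
  define U where "U w = {g \<in> carrier G. gact Smor g x = w}" for w
  have top: "topspace T = carrier G"
    and mult: "continuous_map (prod_topology T T) T (\<lambda>(g, h). g \<otimes> h)"
    using l_group by (simp_all add: l_group_def)
  have open_U: "openin T (U w)" for w
  proof (cases "U w = {}")
    case False
    then obtain k where k: "k \<in> carrier G" "gact Smor k x = w" by (auto simp: U_def)
    \<comment> \<open>\<open>U w\<close> is the left coset of the open stabilizer of
      \<open>x\<close> through \<open>k\<close>, hence its preimage under left multiplication by the
      inverse of \<open>k\<close>.\<close>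
    have "continuous_map T (prod_topology T T) (\<lambda>g. (inv k, g))"
      using k top by (intro continuous_map_pairedI) simp_all
    from continuous_map_compose[OF this mult] have "continuous_map T T (\<lambda>g. inv k \<otimes> g)"
      by (simp add: comp_def)
    hence "openin T {g \<in> topspace T. inv k \<otimes> g \<in> U x}"
      using stab_open[OF x] unfolding U_def by (rule openin_continuous_map_preimage)
    moreover have "gact Smor g x = w \<longleftrightarrow> gact Smor (inv k \<otimes> g) x = x" if g: "g \<in> carrier G" for g
    proof
      assume "gact Smor (inv k \<otimes> g) x = x"
      hence "gact Smor k (gact Smor (inv k) (gact Smor g x)) = w"
        using gact_mult[OF S, of "inv k" g x] k g x by simp
      thus "gact Smor g x = w" using gact_inv'[OF S k(1) gact_closed[OF S g x]] by simp
    qed (use gact_cancel[OF g k(1) x] k(2) in simp)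
    hence "{g \<in> topspace T. inv k \<otimes> g \<in> U x} = U w" using k by (auto simp: U_def top)
    ultimately show ?thesis by simp
  qed simp
  have "compactin T K" using stab_compact[OF y] by (simp add: K_def)
  moreover have "K \<subseteq> \<Union> (range U)" by (auto simp: K_def U_def)
  ultimately obtain \<F> where \<F>: "finite \<F>" "\<F> \<subseteq> range U" "K \<subseteq> \<Union> \<F>"
    using open_U unfolding compactin_def by (metis (no_types, lifting) imageE)
  obtain W where W: "finite W" "\<F> = U ` W"
    using finite_subset_image[OF \<F>(1,2)] by auto
  \<comment> \<open>All elements of \<open>U w\<close> send \<open>x\<close> to the single point
    \<open>w\<close>, so a finite cover leaves finitely many images.\<close>
  have "{gact Smor k x | k. k \<in> carrier G \<and> gact Smor k y = y} \<subseteq> W"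
    using \<F>(3) unfolding W(2) by (auto simp: K_def U_def)
  thus ?thesis using W(1) by (rule finite_subset)
qed

text \<open>The elements sending \<open>z\<close> to \<open>y\<close> form a coset of the stabilizer
  of \<open>y\<close>; translating by one of them reduces to
  \<open>stab_orbit_finite\<close>.\<close>

lemma orbit_hitting_finite:
  assumes x: "x \<in> S X0" and y: "y \<in> S X0" and z: "z \<in> S X0"
  shows "finite {gact Smor g x | g. g \<in> carrier G \<and> gact Smor g z = y}" (is "finite ?A")
proof (cases "?A = {}")
  case False
  then obtain g where g: "g \<in> carrier G" "gact Smor g z = y" by blast
  note gx = gact_closed[OF S g(1) x]
  have "?A \<subseteq> {gact Smor k (gact Smor g x) | k. k \<in> carrier G \<and> gact Smor k y = y}"
  proof
    fix w assume "w \<in> ?A"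
    then obtain h where h: "h \<in> carrier G" "gact Smor h z = y" "w = gact Smor h x" by auto
    have k: "h \<otimes> inv g \<in> carrier G" using h g by simp
    have hg: "gact Smor (h \<otimes> inv g) (gact Smor g v) = gact Smor h v" if v: "v \<in> S X0" for v
      using gact_mult[OF S h(1) inv_closed[OF g(1)] gact_closed[OF S g(1) v]] gact_inv[OF S g(1) v]
      by simp
    have "w = gact Smor (h \<otimes> inv g) (gact Smor g x)" using hg[OF x] h(3) by simp
    moreover have "gact Smor (h \<otimes> inv g) y = y" using hg[OF z] h(2) g(2) by simp
    ultimately show "w \<in> {gact Smor k (gact Smor g x) | k. k \<in> carrier G \<and> gact Smor k y = y}"
      using k by blast
  qed
  thus ?thesis by (rule finite_subset[OF _ stab_orbit_finite[OF gx y]])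
qed (simp only: finite.emptyI)

definition orb :: "'s \<Rightarrow> 's set" where
  "orb x = {gact Smor g x | g. g \<in> carrier G}"

lemma finite_orb: "finite (orb ` S X0)"
proof -
  have "orb ` S X0 = {{gact Smor g x | g. g \<in> carrier G} | x. x \<in> S X0}" by (auto simp: orb_def)
  thus ?thesis using finite_orbits by simp
qed

lemma orb_self: "x \<in> S X0 \<Longrightarrow> x \<in> orb x"
  unfolding orb_def using gact_one[OF S] one_closed by force

text \<open>For linear \<open>t\<close> this is \<open>t\<close> on the embedded copy of FY and zero
  on its orthogonal complement. It gives an endomorphism of FY a matrix indexed by SY.\<close>

definition lift :: "'v obj \<Rightarrow> ('h \<Rightarrow> 'h) \<Rightarrow> ('s \<Rightarrow> complex) \<Rightarrow> 's \<Rightarrow> complex" where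
  "lift Y t \<phi> = emb Y (t (ret Y \<phi>))"

lemma lin_map_lift: "Y \<in> Ob \<Longrightarrow> lin_map (Fob Y) (Fob Y) t \<Longrightarrow> lin_map (l2t (S Y)) (l2t (S Y)) (lift Y t)"
  unfolding lift_def[abs_def] by (rule lin_map_comp[OF lin_map_comp[OF lin_map_ret _] lin_map_emb])

lemma lift_equivariant: "t \<in> EndG \<Longrightarrow> g \<in> carrier G \<Longrightarrow> \<phi> \<in> pcarrier (l2t (S X0)) \<Longrightarrow>
    lift X0 t (push (gact Smor g) \<phi>) = push (gact Smor g) (lift X0 t \<phi>)"
  unfolding lift_def
  by (simp only: ret_gact End_G_equivariant emb_gact End_G_closed ret_closed[OF X0_in_objs])

lemma lift_delta_gact: "t \<in> EndG \<Longrightarrow> g \<in> carrier G \<Longrightarrow> x \<in> S X0 \<Longrightarrow>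
    lift X0 t (delta (gact Smor g x)) = push (gact Smor g) (lift X0 t (delta x))"
  using lift_equivariant[OF _ _ delta_closed] by (simp add: push_delta)

lemma lift_delta_closed: "t \<in> EndG \<Longrightarrow> x \<in> S X0 \<Longrightarrow> lift X0 t (delta x) \<in> pcarrier (l2t (S X0))"
  by (rule lin_map_closed[OF lin_map_lift[OF X0_in_objs End_G_lin_map] delta_closed])

text \<open>One orbit at a time: columns along an orbit are translates of the column of a base
  point, whose finite support leaves finitely many conditions of the form treated in
  \<open>orbit_hitting_finite\<close>.\<close>

lemma lift_rows_finite:
  assumes t: "t \<in> EndG" and y: "y \<in> S X0"
  shows "finite {x \<in> S X0. lift X0 t (delta x) y \<noteq> 0}"
proof -
  have "finite {x \<in> orb x0. lift X0 t (delta x) y \<noteq> 0}" if x0: "x0 \<in> S X0" for x0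
  proof (rule finite_subset)
    let ?Z = "supp (lift X0 t (delta x0))"
    have Z: "finite ?Z" "?Z \<subseteq> S X0" using lift_delta_closed[OF t x0] by simp_all
    show "{x \<in> orb x0. lift X0 t (delta x) y \<noteq> 0} \<subseteq>
        (\<Union>z \<in> ?Z. {gact Smor g x0 | g. g \<in> carrier G \<and> gact Smor g z = y})"
    proof
      fix x assume "x \<in> {x \<in> orb x0. lift X0 t (delta x) y \<noteq> 0}"
      then obtain g where g: "g \<in> carrier G" "x = gact Smor g x0" "lift X0 t (delta x) y \<noteq> 0"
        by (auto simp: orb_def)
      hence "y \<in> supp (push (gact Smor g) (lift X0 t (delta x0)))"
        using lift_delta_gact[OF t g(1) x0] by simp
      then obtain z where "z \<in> ?Z" "y = gact Smor g z" using supp_push by fast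
      thus "x \<in> (\<Union>z \<in> ?Z. {gact Smor g x0 | g. g \<in> carrier G \<and> gact Smor g z = y})"
        using g by blast
    qed
    show "finite (\<Union>z \<in> ?Z. {gact Smor g x0 | g. g \<in> carrier G \<and> gact Smor g z = y})"
      using Z orbit_hitting_finite[OF x0 y] by (intro finite_UN_I) auto
  qed
  hence "finite (\<Union>c \<in> orb ` S X0. {x \<in> c. lift X0 t (delta x) y \<noteq> 0})"
    using finite_orb by (intro finite_UN_I) auto
  moreover have "{x \<in> S X0. lift X0 t (delta x) y \<noteq> 0} \<subseteq>
      (\<Union>c \<in> orb ` S X0. {x \<in> c. lift X0 t (delta x) y \<noteq> 0})"
    using orb_self by auto
  ultimately show ?thesis by (rule rev_finite_subset)
qed

text \<open>Along an orbit the columns are push-forwards of one column, so their norms do not exceed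
  its norm; finitely many orbits then give one bound.\<close>

lemma lift_columns_bounded:
  assumes t: "t \<in> EndG"
  obtains M where "0 \<le> M" "\<And>x. x \<in> S X0 \<Longrightarrow> l1 (lift X0 t (delta x)) \<le> M"
proof -
  have "\<exists>m. \<forall>x\<in>c. l1 (lift X0 t (delta x)) \<le> m" if c: "c \<in> orb ` S X0" for c
  proof -
    obtain x0 where x0: "x0 \<in> S X0" "c = orb x0" using c by auto
    have "l1 (lift X0 t (delta x)) \<le> l1 (lift X0 t (delta x0))" if "x \<in> c" for x
      using that l1_push_le[of "lift X0 t (delta x0)"] lift_delta_closed[OF t x0(1)]
        lift_delta_gact[OF t _ x0(1)] by (auto simp: x0(2) orb_def)
    thus ?thesis by blast
  qed
  then obtain m where m: "\<And>c x. c \<in> orb ` S X0 \<Longrightarrow> x \<in> c \<Longrightarrow> l1 (lift X0 t (delta x)) \<le> m c"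
    by metis
  show thesis
  proof (rule that)
    \<comment> \<open>The sum of absolute values dominates each orbit bound and is nonnegative even
      if SX is empty, where a maximum would need a separate case.\<close>
    show "0 \<le> (\<Sum>c \<in> orb ` S X0. \<bar>m c\<bar>)" by (simp add: sum_nonneg)
    fix x assume x: "x \<in> S X0"
    have "l1 (lift X0 t (delta x)) \<le> \<bar>m (orb x)\<bar>"
      using m[of "orb x" x] orb_self[OF x] x by fastforce
    also have "\<dots> \<le> (\<Sum>c \<in> orb ` S X0. \<bar>m c\<bar>)"
      using x finite_orb by (intro member_le_sum) auto
    finally show "l1 (lift X0 t (delta x)) \<le> (\<Sum>c \<in> orb ` S X0. \<bar>m c\<bar>)" .
  qed
qed

text \<open>\<open>phil_functor\<close> asks only for linear maps; unitarity of the action is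
  inherited from the permutation of SX through \<open>emb\<close>.\<close>

lemma inner_gact:
  assumes g: "g \<in> carrier G" and u: "u \<in> pcarrier (Fob X0)" and v: "v \<in> pcarrier (Fob X0)"
  shows "pinner (Fob X0) (gact Fmor g u) (gact Fmor g v) = pinner (Fob X0) u v"
proof -
  have inj: "inj_on (gact Smor g) (S X0)" by (rule inj_on_inverseI[where g = "gact Smor (inv g)"]) (rule gact_inv[OF S g])
  note eu = emb_closed[OF X0_in_objs u] and ev = emb_closed[OF X0_in_objs v]
  have "pinner (Fob X0) (gact Fmor g u) (gact Fmor g v) =
      pinner (l2t (S X0)) (push (gact Smor g) (emb X0 u)) (push (gact Smor g) (emb X0 v))"
    using inner_emb_emb[OF X0_in_objs F_gact_closed[OF g u] F_gact_closed[OF g v]]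
    by (simp add: emb_gact g u v)
  also have "\<dots> = (\<Sum>x\<in>supp (emb X0 u). emb X0 u x * cnj (emb X0 v x))"
    using eu ev push_inj[OF inj, of "emb X0 v"]
    by (subst inner_push_left) (auto intro!: sum.cong)
  also have "\<dots> = pinner (Fob X0) u v"
    using inner_emb_emb[OF X0_in_objs u v] by (simp add: l2t_def)
  finally show ?thesis .
qed

lemma inner_gact_left:
  assumes g: "g \<in> carrier G" and u: "u \<in> pcarrier (Fob X0)" and v: "v \<in> pcarrier (Fob X0)"
  shows "pinner (Fob X0) (gact Fmor g u) v = pinner (Fob X0) u (gact Fmor (inv g) v)"
  using inner_gact[OF g u F_gact_closed[OF inv_closed[OF g] v]] gact_inv'[OF FS g] v by simp

text \<open>The adjoint exists on functions because the lifted matrix has finite rows, and descends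
  to FX by \<open>ret\<close>. Equivariance passes to it because the action is unitary.\<close>

lemma End_G_adjoint:
  assumes t: "t \<in> EndG"
  obtains s where "s \<in> EndG" "is_adjoint (Fob X0) s t"
proof -
  interpret V: pre_hilbert_space "Fob X0" by (rule pre_hilbert_space_Fob[OF X0_in_objs])
  have "\<exists>w \<in> pcarrier (Fob X0). \<forall>u \<in> pcarrier (Fob X0). pinner (Fob X0) (t u) v = pinner (Fob X0) u w"
    if v: "v \<in> pcarrier (Fob X0)" for v
  proof -
    note L = lin_map_lift[OF X0_in_objs End_G_lin_map[OF t]]
    have "\<exists>\<eta> \<in> pcarrier (l2t (S X0)). \<forall>\<phi> \<in> pcarrier (l2t (S X0)).
        pinner (l2t (S X0)) (lift X0 t \<phi>) (emb X0 v) = pinner (l2t (S X0)) \<phi> \<eta>"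
      by (rule l2t_adjoint_vector[OF L lift_rows_finite[OF t] emb_closed[OF X0_in_objs v]])
    then obtain \<eta> where \<eta>: "\<eta> \<in> pcarrier (l2t (S X0))" and
      "\<forall>\<phi> \<in> pcarrier (l2t (S X0)).
        pinner (l2t (S X0)) (lift X0 t \<phi>) (emb X0 v) = pinner (l2t (S X0)) \<phi> \<eta>"
      by (elim bexE) (rule that)
    note adj = this(2)[THEN bspec]
    \<comment> \<open>Test on \<open>emb X0 u\<close>: its lift is \<open>emb X0 (t u)\<close>, and
      adjointness of \<open>emb\<close> and \<open>ret\<close> turns \<open>\<eta>\<close> into
      \<open>ret X0 \<eta>\<close>.\<close>
    have "pinner (Fob X0) (t u) v = pinner (Fob X0) u (ret X0 \<eta>)" if u: "u \<in> pcarrier (Fob X0)" for u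
      using adj[OF emb_closed[OF X0_in_objs u]] inner_emb[OF X0_in_objs u \<eta>]
        inner_emb_emb[OF X0_in_objs End_G_closed[OF t u] v]
      by (simp add: lift_def ret_emb[OF X0_in_objs u])
    thus ?thesis using ret_closed[OF X0_in_objs \<eta>] by blast
  qed
  then obtain s0 where s0: "\<And>v. v \<in> pcarrier (Fob X0) \<Longrightarrow> s0 v \<in> pcarrier (Fob X0)"
    "\<And>u v. u \<in> pcarrier (Fob X0) \<Longrightarrow> v \<in> pcarrier (Fob X0) \<Longrightarrow>
      pinner (Fob X0) (t u) v = pinner (Fob X0) u (s0 v)"
    by metis
  \<comment> \<open>The chosen function is arbitrary off the carrier, where \<open>End_G\<close>
    demands the zero vector.\<close>
  define s where "s v = (if v \<in> pcarrier (Fob X0) then s0 v else pzero (Fob X0))" for v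
  have s: "s v \<in> pcarrier (Fob X0)" if "v \<in> pcarrier (Fob X0)" for v
    using that s0 by (simp add: s_def)
  have adj: "is_adjoint (Fob X0) s t" using s0 by (simp add: s_def is_adjoint_def)
  have adj': "pinner (Fob X0) (s u) v = pinner (Fob X0) u (t v)"
    if "u \<in> pcarrier (Fob X0)" "v \<in> pcarrier (Fob X0)" for u v
    using V.adjoint_swap[OF adj End_G_closed[OF t] s] that by (simp add: is_adjoint_def)
  have "s (gact Fmor g v) = gact Fmor g (s v)" if g: "g \<in> carrier G" and v: "v \<in> pcarrier (Fob X0)" for g v
  proof (rule V.vector_eqI)
    fix w assume w: "w \<in> pcarrier (Fob X0)"
    note gw = F_gact_closed[OF inv_closed[OF g] w]
    have "pinner (Fob X0) (gact Fmor g (s v)) w = pinner (Fob X0) v (t (gact Fmor (inv g) w))"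
      using inner_gact_left[OF g s[OF v] w] adj'[OF v gw] by simp
    also have "\<dots> = pinner (Fob X0) v (gact Fmor (inv g) (t w))"
      using End_G_equivariant[OF t inv_closed[OF g] w] by simp
    also have "\<dots> = pinner (Fob X0) (s (gact Fmor g v)) w"
      using inner_gact_left[OF g v End_G_closed[OF t w]] adj'[OF F_gact_closed[OF g v] w] by simp
    finally show "pinner (Fob X0) (s (gact Fmor g v)) w = pinner (Fob X0) (gact Fmor g (s v)) w" ..
  qed (intro s F_gact_closed g v)+
  moreover have "s u = pzero (Fob X0)" if "u \<notin> pcarrier (Fob X0)" for u
    using that by (simp add: s_def)
  ultimately have "s \<in> EndG"
    using V.adjoint_linear[OF adj End_G_closed[OF t] s] by (simp add: End_G_def Let_def S_act_def)
  thus thesis using adj by (rule that)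
qed

section \<open>Extension to the quotients\<close>

text \<open>Naturality with respect to the projections leaves no other choice on the carrier: lift
  to FX, apply \<open>t\<close>, project. The values elsewhere follow the convention of
  \<open>op_family\<close>.\<close>

definition induced :: "('h \<Rightarrow> 'h) \<Rightarrow> 'v obj \<Rightarrow> 'h \<Rightarrow> 'h" where
  "induced t Y = (if Y \<in> Ob then (\<lambda>u. if u \<in> pcarrier (Fob Y)
     then proj Fmor Y (t (SOME w. w \<in> pcarrier (Fob X0) \<and> proj Fmor Y w = u))
     else pzero (Fob Y)) else undefined)"

text \<open>Well-definedness needs no description of the kernel of the projection: the adjoint
  endomorphism shows that t maps this kernel to vectors with image orthogonal to everything.\<close>

lemma proj_End_G_cong:
  assumes Y: "Y \<in> Ob" and t: "t \<in> EndG" and u: "u \<in> pcarrier (Fob X0)" and w: "w \<in> pcarrier (Fob X0)"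
    and eq: "proj Fmor Y u = proj Fmor Y w"
  shows "proj Fmor Y (t u) = proj Fmor Y (t w)"
proof -
  interpret V: pre_hilbert_space "Fob Y" by (rule pre_hilbert_space_Fob[OF Y])
  obtain s where s: "s \<in> EndG" "is_adjoint (Fob X0) s t" by (rule End_G_adjoint[OF t])
  show ?thesis
  proof (rule V.vector_eqI)
    fix v assume "v \<in> pcarrier (Fob Y)"
    then obtain v' where "v' \<in> pcarrier (Fob X0)" "v = proj Fmor Y v'" by (metis proj_surj[OF Y])
    thus "pinner (Fob Y) (proj Fmor Y (t u)) v = pinner (Fob Y) (proj Fmor Y (t w)) v"
      using inner_proj_adjoint[OF Y t End_G_closed[OF s(1)] s(2)] u w eq by simp
  qed (rule F_proj_closed[OF Y End_G_closed[OF t u]], rule F_proj_closed[OF Y End_G_closed[OF t w]])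
qed

lemma induced_proj:
  assumes Y: "Y \<in> Ob" and t: "t \<in> EndG" and u: "u \<in> pcarrier (Fob X0)"
  shows "induced t Y (proj Fmor Y u) = proj Fmor Y (t u)"
proof -
  let ?w = "SOME w. w \<in> pcarrier (Fob X0) \<and> proj Fmor Y w = proj Fmor Y u"
  have "?w \<in> pcarrier (Fob X0) \<and> proj Fmor Y ?w = proj Fmor Y u"
    by (rule someI[of _ u]) (simp add: u)
  thus ?thesis using proj_End_G_cong[OF Y t _ u, of ?w] Y F_proj_closed[OF Y u]
    by (simp add: induced_def)
qed

lemma induced_X0: assumes t: "t \<in> EndG" shows "induced t X0 = t"
proof
  fix u
  show "induced t X0 u = t u"
  proof (cases "u \<in> pcarrier (Fob X0)")
    case True
    thus ?thesis using induced_proj[OF X0_in_objs t True] End_G_closed[OF t True] proj_X0[OF FS] by simp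
  qed (simp add: induced_def X0_in_objs End_G_outside[OF t])
qed

lemma induced_natural:
  assumes t: "t \<in> EndG"
  shows "natural G act X Fob Fmor (induced t)"
proof (rule naturalI)
  fix Y assume Y: "Y \<in> Ob"
  note P = lin_map_proj[OF F Y] and t_lin = End_G_lin_map[OF t]
  interpret V0: pre_hilbert_space "Fob X0" by (rule pre_hilbert_space_Fob[OF X0_in_objs])
  show "lin_map (Fob Y) (Fob Y) (induced t Y)"
    unfolding lin_map_def
  proof (intro conjI ballI allI)
    fix u assume u: "u \<in> pcarrier (Fob Y)"
    then obtain u' where u': "u' \<in> pcarrier (Fob X0)" "proj Fmor Y u' = u" by (rule proj_surj[OF Y])
    note tu' = End_G_closed[OF t u'(1)]
    show "induced t Y u \<in> pcarrier (Fob Y)"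
      using induced_proj[OF Y t u'(1)] u'(2) F_proj_closed[OF Y tu'] by simp
    show "induced t Y (pscale (Fob Y) c u) = pscale (Fob Y) c (induced t Y u)" for c
      using induced_proj[OF Y t V0.scale_closed[OF u'(1)], of c] induced_proj[OF Y t u'(1)] u'
      by (simp add: lin_map_scale[OF P] lin_map_scale[OF t_lin] tu')
    fix v assume v: "v \<in> pcarrier (Fob Y)"
    then obtain v' where v': "v' \<in> pcarrier (Fob X0)" "proj Fmor Y v' = v" by (rule proj_surj[OF Y])
    show "induced t Y (padd (Fob Y) u v) = padd (Fob Y) (induced t Y u) (induced t Y v)"
      using induced_proj[OF Y t V0.add_closed[OF u'(1) v'(1)]] induced_proj[OF Y t u'(1)]
        induced_proj[OF Y t v'(1)] u' v'
      by (simp add: lin_map_add[OF P] lin_map_add[OF t_lin] tu' End_G_closed[OF t v'(1)])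
  qed
next
  fix Y Z m u assume Y: "Y \<in> Ob" and Z: "Z \<in> Ob" and m: "m \<in> homs G act X Y Z"
    and u: "u \<in> pcarrier (Fob Y)"
  show "induced t Z (Fmor Y Z m u) = Fmor Y Z m (induced t Y u)"
  \<comment> \<open>The two kinds of morphisms in \<open>homs\<close>: out of X equivariance of
    \<open>t\<close> is needed, out of a proper quotient only the compatibility of
    projections.\<close>
  proof (cases "Y = X0")
    case True
    then obtain g where g: "g \<in> carrier G" "m = mor act X0 Z g"
      using m Z by (auto simp: homs_def X0_in_objs)
    have u0: "u \<in> pcarrier (Fob X0)" using u True by simp
    have "Fmor X0 Z m v = proj Fmor Z (gact Fmor g v)" if "v \<in> pcarrier (Fob X0)" for v
      using mor_X_proj[OF FS Z g(1) that] g(2) by simp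
    thus ?thesis
      using u0 End_G_closed[OF t u0] induced_proj[OF Z t F_gact_closed[OF g(1) u0]]
        End_G_equivariant[OF t g(1) u0] True by (simp add: induced_X0[OF t])
  next
    case False
    obtain u' where u': "u' \<in> pcarrier (Fob X0)" "proj Fmor Y u' = u" by (rule proj_surj[OF Y u])
    have "Fmor Y Z m (proj Fmor Y v) = proj Fmor Z v" if "v \<in> pcarrier (Fob X0)" for v
      using mor_proj[OF FS Y Z False m that] .
    from this[OF u'(1)] this[OF End_G_closed[OF t u'(1)]] show ?thesis
      using u' induced_proj[OF Z t u'(1)] induced_proj[OF Y t u'(1)] by simp
  qed
qed (simp_all add: induced_def)

lemma induced_adjoint:
  assumes Y: "Y \<in> Ob" and t: "t \<in> EndG" and s: "s \<in> EndG" and adj: "is_adjoint (Fob X0) s t"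
  shows "is_adjoint (Fob Y) (induced s Y) (induced t Y)"
  unfolding is_adjoint_def
proof (intro ballI)
  fix u v assume "u \<in> pcarrier (Fob Y)" "v \<in> pcarrier (Fob Y)"
  then obtain u' v' where u': "u' \<in> pcarrier (Fob X0)" "u = proj Fmor Y u'"
    and v': "v' \<in> pcarrier (Fob X0)" "v = proj Fmor Y v'" by (metis proj_surj[OF Y])
  show "pinner (Fob Y) (induced t Y u) v = pinner (Fob Y) u (induced s Y v)"
    using inner_proj_adjoint[OF Y t End_G_closed[OF s] adj u'(1) v'(1)] u' v'
    by (simp add: induced_proj[OF Y t] induced_proj[OF Y s])
qed

text \<open>The adjoint family is the one induced by the adjoint of \<open>t\<close>, so it is
  natural for the same reason.\<close>

lemma induced_CF_operator: "t \<in> EndG \<Longrightarrow> induced t \<in> CF_operators G act X Fob Fmor"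
  by (metis CF_operatorsI End_G_adjoint induced_adjoint induced_natural)

section \<open>Operators and equivariant endomorphisms correspond\<close>

lemma natural_X0_End_G:
  assumes a: "natural G act X Fob Fmor a"
  shows "a X0 \<in> EndG"
  using natural_lin_map[OF a X0_in_objs] natural_outside[OF a X0_in_objs]
    natural_commute[OF a X0_in_objs X0_in_objs] mor_in_homs[OF X0_in_objs]
  by (simp add: End_G_def Let_def)

lemma natural_proj: "natural G act X Fob Fmor a \<Longrightarrow> Y \<in> Ob \<Longrightarrow> u \<in> pcarrier (Fob X0) \<Longrightarrow>
    a Y (proj Fmor Y u) = proj Fmor Y (a X0 u)"
  unfolding proj_def by (intro natural_commute X0_in_objs mor_in_homs one_closed)

text \<open>Every vector of FY is projected from FX, so naturality determines the component at Y
  from the one at X.\<close>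

lemma natural_eqI:
  assumes a: "natural G act X Fob Fmor a" and b: "natural G act X Fob Fmor b" and eq: "a X0 = b X0"
  shows "a = b"
proof
  fix Y
  show "a Y = b Y"
  proof (cases "Y \<in> Ob")
    case Y: True
    show ?thesis
    proof
      fix u
      show "a Y u = b Y u"
      proof (cases "u \<in> pcarrier (Fob Y)")
        case True
        then obtain w where "w \<in> pcarrier (Fob X0)" "proj Fmor Y w = u" by (rule proj_surj[OF Y])
        thus ?thesis using natural_proj[OF a Y, of w] natural_proj[OF b Y, of w] eq by simp
      qed (simp add: natural_outside[OF a Y] natural_outside[OF b Y])
    qed
  qed (simp add: natural_undefined[OF a] natural_undefined[OF b])
qed

lemma bij_betw_CF_operators_End_G: "bij_betw (\<lambda>a. a X0) (CF_operators G act X Fob Fmor) EndG"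
proof (rule bij_betw_imageI)
  show "inj_on (\<lambda>a. a X0) (CF_operators G act X Fob Fmor)"
    by (rule inj_onI) (metis CF_operatorsE natural_eqI)
  show "(\<lambda>a. a X0) ` CF_operators G act X Fob Fmor = EndG"
  proof (intro equalityI subsetI)
    fix t assume "t \<in> (\<lambda>a. a X0) ` CF_operators G act X Fob Fmor"
    thus "t \<in> EndG" by (auto simp: CF_operators_def intro: natural_X0_End_G)
  next
    fix t assume t: "t \<in> EndG"
    show "t \<in> (\<lambda>a. a X0) ` CF_operators G act X Fob Fmor"
      by (rule image_eqI[OF _ induced_CF_operator[OF t]]) (simp add: induced_X0[OF t])
  qed
qed

section \<open>Uniform bounds\<close>

lemma lift_proj:
  assumes a: "natural G act X Fob Fmor a" and Y: "Y \<in> Ob" and \<phi>: "\<phi> \<in> pcarrier (l2t (S X0))"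
  shows "lift Y (a Y) (push (proj Smor Y) \<phi>) = push (proj Smor Y) (lift X0 (a X0) \<phi>)"
proof -
  note r = ret_closed[OF X0_in_objs \<phi>]
  show ?thesis unfolding lift_def ret_proj[OF Y \<phi>] natural_proj[OF a Y r]
    by (rule emb_proj[OF Y natural_closed[OF a X0_in_objs r]])
qed

text \<open>Each point of SY is the image of a point of SX, and its column is the push-forward of
  the column upstairs. The bound on SX therefore holds for all objects at once.\<close>

lemma natural_columns_bounded:
  assumes a: "natural G act X Fob Fmor a"
  obtains M where "0 \<le> M" "\<And>Y x. Y \<in> Ob \<Longrightarrow> x \<in> S Y \<Longrightarrow> l1 (lift Y (a Y) (delta x)) \<le> M"
proof -
  note t = natural_X0_End_G[OF a]
  obtain M where M: "0 \<le> M" "\<And>x. x \<in> S X0 \<Longrightarrow> l1 (lift X0 (a X0) (delta x)) \<le> M"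
    by (metis lift_columns_bounded[OF t])
  have "l1 (lift Y (a Y) (delta x)) \<le> M" if Y: "Y \<in> Ob" and x: "x \<in> S Y" for Y x
  proof -
    have "proj Smor Y ` S X0 = S Y" using quotient_fibres[OF Y] by (elim exE conjE)
    then obtain x' where x': "x' \<in> S X0" "x = proj Smor Y x'" using x by auto
    have "l1 (lift Y (a Y) (delta x)) = l1 (push (proj Smor Y) (lift X0 (a X0) (delta x')))"
      using lift_proj[OF a Y delta_closed[OF x'(1)]] by (simp add: x'(2) push_delta)
    also have "\<dots> \<le> l1 (lift X0 (a X0) (delta x'))"
      by (rule l1_push_le) (use lift_delta_closed[OF t x'(1)] in simp)
    finally show ?thesis using M(2)[OF x'(1)] by simp
  qed
  thus thesis using M(1) by (rule that[rotated])
qed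

lemma lift_adjoint:
  assumes Y: "Y \<in> Ob" and adj: "is_adjoint (Fob Y) b a"
    and a: "\<And>u. u \<in> pcarrier (Fob Y) \<Longrightarrow> a u \<in> pcarrier (Fob Y)"
    and b: "\<And>u. u \<in> pcarrier (Fob Y) \<Longrightarrow> b u \<in> pcarrier (Fob Y)"
  shows "is_adjoint (l2t (S Y)) (lift Y b) (lift Y a)"
  unfolding is_adjoint_def
proof (intro ballI)
  interpret V: pre_hilbert_space "Fob Y" by (rule pre_hilbert_space_Fob[OF Y])
  fix \<phi> \<psi> assume \<phi>: "\<phi> \<in> pcarrier (l2t (S Y))" and \<psi>: "\<psi> \<in> pcarrier (l2t (S Y))"
  note r\<phi> = ret_closed[OF Y \<phi>] and r\<psi> = ret_closed[OF Y \<psi>]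
  have "pinner (l2t (S Y)) (lift Y a \<phi>) \<psi> = pinner (Fob Y) (ret Y \<phi>) (b (ret Y \<psi>))"
    using inner_emb[OF Y a[OF r\<phi>] \<psi>] adj r\<phi> r\<psi> by (simp add: lift_def is_adjoint_def)
  \<comment> \<open>\<open>inner_emb\<close> has the embedded vector on the left, so the adjunction
    is used a second time with the arguments exchanged.\<close>
  also have "\<dots> = cnj (pinner (l2t (S Y)) (lift Y b \<psi>) \<phi>)"
    using inner_emb[OF Y b[OF r\<psi>] \<phi>] V.inner_commute[OF r\<phi> b[OF r\<psi>]] by (simp add: lift_def)
  also have "\<dots> = pinner (l2t (S Y)) \<phi> (lift Y b \<psi>)"
    using l2t_inner_commute[of \<phi> "lift Y b \<psi>" "S Y"] \<phi> emb_closed[OF Y b[OF r\<psi>]]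
    by (simp add: lift_def)
  finally show "pinner (l2t (S Y)) (lift Y a \<phi>) \<psi> = pinner (l2t (S Y)) \<phi> (lift Y b \<psi>)" .
qed

text \<open>Schur's test for the lifted operator, with \<open>M\<close> bounding its columns and
  \<open>N\<close> those of its adjoint, both independent of the object; the isometry
  \<open>emb\<close> carries the estimate back to FY.\<close>

lemma CF_operators_bounded:
  assumes "a \<in> CF_operators G act X Fob Fmor"
  shows "\<exists>M \<ge> 0. \<forall>Y \<in> Ob. \<forall>u \<in> pcarrier (Fob Y). pnorm (Fob Y) (a Y u) \<le> M * pnorm (Fob Y) u"
proof -
  obtain b where a: "natural G act X Fob Fmor a" and b: "natural G act X Fob Fmor b"
    and adj: "\<And>Y. Y \<in> Ob \<Longrightarrow> is_adjoint (Fob Y) (b Y) (a Y)"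
    using CF_operatorsE[OF assms] by metis
  obtain M where M: "0 \<le> M" "\<And>Y x. Y \<in> Ob \<Longrightarrow> x \<in> S Y \<Longrightarrow> l1 (lift Y (a Y) (delta x)) \<le> M"
    by (metis natural_columns_bounded[OF a])
  obtain N where N: "0 \<le> N" "\<And>Y x. Y \<in> Ob \<Longrightarrow> x \<in> S Y \<Longrightarrow> l1 (lift Y (b Y) (delta x)) \<le> N"
    by (metis natural_columns_bounded[OF b])
  have "pnorm (Fob Y) (a Y u) \<le> max M N * pnorm (Fob Y) u"
    if Y: "Y \<in> Ob" and u: "u \<in> pcarrier (Fob Y)" for Y u
  proof -
    have norm: "pnorm (l2t (S Y)) (emb Y v) = pnorm (Fob Y) v" if "v \<in> pcarrier (Fob Y)" for v
      using inner_emb_emb[OF Y that that] by (simp add: pnorm_def)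
    have "pnorm (l2t (S Y)) (lift Y (a Y) (emb Y u)) \<le> max M N * pnorm (l2t (S Y)) (emb Y u)"
    proof (rule l2t_schur_test)
      show "lin_map (l2t (S Y)) (l2t (S Y)) (lift Y (a Y))" "lin_map (l2t (S Y)) (l2t (S Y)) (lift Y (b Y))"
        by (intro lin_map_lift Y natural_lin_map[OF a] natural_lin_map[OF b])+
      show "is_adjoint (l2t (S Y)) (lift Y (b Y)) (lift Y (a Y))"
        by (rule lift_adjoint[OF Y adj[OF Y] natural_closed[OF a Y] natural_closed[OF b Y]])
      show "l1 (lift Y (a Y) (delta x)) \<le> max M N" if "x \<in> S Y" for x using M(2)[OF Y that] by simp
      show "l1 (lift Y (b Y) (delta x)) \<le> max M N" if "x \<in> S Y" for x using N(2)[OF Y that] by simp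
      show "0 \<le> max M N" using M(1) by simp
      show "emb Y u \<in> pcarrier (l2t (S Y))" by (rule emb_closed[OF Y u])
    qed
    thus ?thesis using norm[OF u] norm[OF natural_closed[OF a Y u]] by (simp add: lift_def ret_emb[OF Y u])
  qed
  thus ?thesis using M(1) by (intro exI[of _ "max M N"]) auto
qed

end

section \<open>Semi-elementary functors\<close>

lemma dsum_simps:
  "pcarrier (dsum V W) = pcarrier V \<times> pcarrier W"
  "padd (dsum V W) p q = (padd V (fst p) (fst q), padd W (snd p) (snd q))"
  "pscale (dsum V W) c p = (pscale V c (fst p), pscale W c (snd p))"
  "pinner (dsum V W) p q = pinner V (fst p) (fst q) + pinner W (snd p) (snd q)"
  by (simp_all add: dsum_def case_prod_beta)

text \<open>With \<open>U\<close> the unitary isomorphism onto the direct sum, \<open>ret\<close> is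
  its first component and \<open>emb\<close> is its inverse on vectors with second component
  zero.\<close>

lemma (in G_complex_setting) semi_elementary_l2_retract:
  assumes F: "phil_functor G act X Fob Fmor"
    and semi: "semi_elementary_via G T act X Fob Fmor Fob' Fmor' S Smor"
  shows "\<exists>emb ret. l2_retract G T act X Fob Fmor S Smor emb ret"
proof -
  let ?D = "dsum_ob Fob Fob'" and ?Dm = "dsum_mor Fmor Fmor'"
  have F': "phil_functor G act X Fob' Fmor'" and el: "elementary_via G T act X ?D ?Dm S Smor"
    using semi by (simp_all add: semi_elementary_via_def)
  note el = el[unfolded elementary_via_def Let_def]
  have S: "set_functor G act X S Smor" using el by (rule conjunct1)
  note el = el[THEN conjunct2]
  obtain U where "\<forall>Y \<in> Ob. unitary_map (l2t (S Y)) (?D Y) (U Y)"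
    and nat: "\<forall>Y \<in> Ob. \<forall>Z \<in> Ob. \<forall>m \<in> homs G act X Y Z. \<forall>\<phi> \<in> pcarrier (l2t (S Y)).
      U Z (push (Smor Y Z m) \<phi>) = ?Dm Y Z m (U Y \<phi>)"
    using el[THEN conjunct1] by (elim exE conjE) (rule that)
  note unit = this(1)[THEN bspec, unfolded unitary_map_def dsum_ob_def]
  have U_lin: "lin_map (l2t (S Y)) (dsum (Fob Y) (Fob' Y)) (U Y)"
    and U_bij: "bij_betw (U Y) (pcarrier (l2t (S Y))) (pcarrier (Fob Y) \<times> pcarrier (Fob' Y))"
    and U_inner: "\<phi> \<in> pcarrier (l2t (S Y)) \<Longrightarrow> \<psi> \<in> pcarrier (l2t (S Y)) \<Longrightarrow>
      pinner (dsum (Fob Y) (Fob' Y)) (U Y \<phi>) (U Y \<psi>) = pinner (l2t (S Y)) \<phi> \<psi>"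
    if "Y \<in> Ob" for Y \<phi> \<psi>
    using unit[OF that] by (simp_all add: dsum_simps del: l2t_simps)
  have U_inj: "\<phi> = \<psi>" if "Y \<in> Ob" "\<phi> \<in> pcarrier (l2t (S Y))" "\<psi> \<in> pcarrier (l2t (S Y))" "U Y \<phi> = U Y \<psi>"
    for Y \<phi> \<psi>
    using inj_onD[OF bij_betw_imp_inj_on[OF U_bij[OF that(1)]] that(4,2,3)] .
  have U_mem: "fst (U Y \<phi>) \<in> pcarrier (Fob Y)" "snd (U Y \<phi>) \<in> pcarrier (Fob' Y)"
    if "Y \<in> Ob" "\<phi> \<in> pcarrier (l2t (S Y))" for Y \<phi>
    using bij_betwE[OF U_bij[OF that(1)]] that(2) by (auto simp: mem_Times_iff simp del: l2t_simps)
  have U_nat: "U Z (push (Smor Y Z m) \<phi>) = (Fmor Y Z m (fst (U Y \<phi>)), Fmor' Y Z m (snd (U Y \<phi>)))"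
    if "Y \<in> Ob" "Z \<in> Ob" "m \<in> homs G act X Y Z" "\<phi> \<in> pcarrier (l2t (S Y))" for Y Z m \<phi>
    using nat that by (simp add: dsum_mor_def case_prod_beta del: l2t_simps)
  have push_l2: "push (Smor Y Z m) \<phi> \<in> pcarrier (l2t (S Z))"
    if "Y \<in> Ob" "Z \<in> Ob" "m \<in> homs G act X Y Z" "\<phi> \<in> pcarrier (l2t (S Y))" for Y Z m \<phi>
    by (rule push_closed[OF that(4)]) (use functor_closed[OF S that(1-3)] in auto)
  define ret where "ret Y \<phi> = fst (U Y \<phi>)" for Y \<phi>
  define emb where "emb Y u = inv_into (pcarrier (l2t (S Y))) (U Y) (u, pzero (Fob' Y))" for Y u
  note H' = pre_hilbert_space.intro[OF pre_hilbert_Fob[OF F']]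
  have pair: "(u, pzero (Fob' Y)) \<in> U Y ` pcarrier (l2t (S Y))" if "Y \<in> Ob" "u \<in> pcarrier (Fob Y)" for Y u
    using bij_betw_imp_surj_on[OF U_bij[OF that(1)]] that(2)
      pre_hilbert_space.zero_closed[OF H'[OF that(1)]] by (simp add: mem_Times_iff)
  have emb_mem: "emb Y u \<in> pcarrier (l2t (S Y))" and U_emb: "U Y (emb Y u) = (u, pzero (Fob' Y))"
    if "Y \<in> Ob" "u \<in> pcarrier (Fob Y)" for Y u
    unfolding emb_def by (rule inv_into_into[OF pair[OF that]], rule f_inv_into_f[OF pair[OF that]])
  have "l2_retract G T act X Fob Fmor S Smor emb ret"
  proof (intro l2_retract.intro l2_retract_axioms.intro G_complex_setting_axioms F S)
    fix Y assume Y: "Y \<in> Ob"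
    interpret V: pre_hilbert_space "Fob Y" by unfold_locales (rule pre_hilbert_Fob[OF F Y])
    interpret V': pre_hilbert_space "Fob' Y" by (rule H'[OF Y])
    show "lin_map (Fob Y) (l2t (S Y)) (emb Y)" unfolding lin_map_def
    proof (intro conjI ballI allI)
      fix u assume u: "u \<in> pcarrier (Fob Y)"
      note eu = emb_mem[OF Y u]
      show "emb Y u \<in> pcarrier (l2t (S Y))" by (rule eu)
      \<comment> \<open>Identities for \<open>emb\<close> are verified after applying the injective
        map \<open>U Y\<close>, where they become identities of pairs.\<close>
      show "emb Y (pscale (Fob Y) c u) = pscale (l2t (S Y)) c (emb Y u)" for c
      proof (rule U_inj[OF Y emb_mem[OF Y V.scale_closed[OF u]]])
        show "pscale (l2t (S Y)) c (emb Y u) \<in> pcarrier (l2t (S Y))" using eu by auto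
        show "U Y (emb Y (pscale (Fob Y) c u)) = U Y (pscale (l2t (S Y)) c (emb Y u))"
          unfolding lin_map_scale[OF U_lin[OF Y] eu] U_emb[OF Y u] U_emb[OF Y V.scale_closed[OF u]]
          by (simp add: dsum_simps V'.scale_zero_right)
      qed
      fix v assume v: "v \<in> pcarrier (Fob Y)"
      note ev = emb_mem[OF Y v]
      show "emb Y (padd (Fob Y) u v) = padd (l2t (S Y)) (emb Y u) (emb Y v)"
      proof (rule U_inj[OF Y emb_mem[OF Y V.add_closed[OF u v]]])
        have "supp (\<lambda>y. emb Y u y + emb Y v y) \<subseteq> supp (emb Y u) \<union> supp (emb Y v)" by auto
        thus "padd (l2t (S Y)) (emb Y u) (emb Y v) \<in> pcarrier (l2t (S Y))"
          using eu ev by (auto intro: finite_subset)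
        show "U Y (emb Y (padd (Fob Y) u v)) = U Y (padd (l2t (S Y)) (emb Y u) (emb Y v))"
          unfolding lin_map_add[OF U_lin[OF Y] eu ev] U_emb[OF Y u] U_emb[OF Y v]
            U_emb[OF Y V.add_closed[OF u v]]
          by (simp add: dsum_simps V'.add_zero V'.zero_closed)
      qed
    qed
    show "lin_map (l2t (S Y)) (Fob Y) (ret Y)"
      unfolding lin_map_def ret_def
      by (intro conjI ballI allI U_mem(1)[OF Y])
        (simp_all add: lin_map_add[OF U_lin[OF Y]] lin_map_scale[OF U_lin[OF Y]] dsum_simps del: l2t_simps)
    show "ret Y (emb Y u) = u" if "u \<in> pcarrier (Fob Y)" for u
      by (simp add: ret_def U_emb[OF Y that])
    show "pinner (l2t (S Y)) (emb Y u) \<phi> = pinner (Fob Y) u (ret Y \<phi>)"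
      if u: "u \<in> pcarrier (Fob Y)" and \<phi>: "\<phi> \<in> pcarrier (l2t (S Y))" for u \<phi>
      using U_inner[OF Y emb_mem[OF Y u] \<phi>] V'.inner_zero_left[OF U_mem(2)[OF Y \<phi>]]
      by (simp add: U_emb[OF Y u] dsum_simps ret_def)
    fix Z m assume Z: "Z \<in> Ob" and m: "m \<in> homs G act X Y Z"
    show "ret Z (push (Smor Y Z m) \<phi>) = Fmor Y Z m (ret Y \<phi>)" if "\<phi> \<in> pcarrier (l2t (S Y))" for \<phi>
      by (simp add: ret_def U_nat[OF Y Z m that])
    show "emb Z (Fmor Y Z m u) = push (Smor Y Z m) (emb Y u)" if u: "u \<in> pcarrier (Fob Y)" for u
    proof -
      note Fu = lin_map_closed[OF lin_map_Fmor[OF F Y Z m] u]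
      \<comment> \<open>Linearity of the complementary functor keeps the second component zero,
        which makes \<open>emb\<close> natural.\<close>
      have "Fmor' Y Z m (pzero (Fob' Y)) = pzero (Fob' Z)"
        by (rule lin_map_zero[OF pre_hilbert_Fob[OF F' Y] pre_hilbert_Fob[OF F' Z] lin_map_Fmor[OF F' Y Z m]])
      thus ?thesis
        by (intro U_inj[OF Z emb_mem[OF Z Fu] push_l2[OF Y Z m emb_mem[OF Y u]]])
          (simp add: U_nat[OF Y Z m emb_mem[OF Y u]] U_emb[OF Y u] U_emb[OF Z Fu])
    qed
  next
    note stab = el[THEN conjunct2, THEN conjunct1, THEN bspec]
    fix x assume x: "x \<in> S X0"
    show "compactin T {g \<in> carrier G. gact Smor g x = x}" by (rule stab[OF x, THEN conjunct1])
    show "openin T {g \<in> carrier G. gact Smor g x = x}"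
      by (rule stab[OF x, THEN conjunct2, THEN conjunct1])
    show "\<exists>c \<in> X. c \<noteq> {} \<and> {g \<in> carrier G. gact Smor g x = x} \<subseteq> cell_stab G act c"
      by (rule stab[OF x, THEN conjunct2, THEN conjunct2])
  next
    fix H assume "le_X G act X H"
    thus "bij_betw (\<lambda>c. the_elem (proj Smor (quot act H X) ` c))
        {{gact Smor h x | h. h \<in> H} | x. x \<in> S X0} (S (quot act H X))"
      unfolding proj_def[abs_def]
      by (rule el[THEN conjunct2, THEN conjunct2, THEN conjunct1, THEN spec, THEN mp])
  next
    show "finite {{gact Smor g x | g. g \<in> carrier G} | x. x \<in> S X0}"
      by (rule el[THEN conjunct2, THEN conjunct2, THEN conjunct2])
  qed
  thus ?thesis by blast
qed

text \<open>The operations on families are componentwise, so evaluation at \<open>X0\<close>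
  respects them by definition. What remains for the isomorphism of *-algebras is bijectivity,
  closure under the operations, and an adjoint that is again an operator.\<close>

theorem theorem4p15:
  fixes G :: "('g, 'm) monoid_scheme" and T :: "'g topology"
    and act :: "'g \<Rightarrow> 'v \<Rightarrow> 'v" and X :: "'v set set"
    and Fob :: "'v obj \<Rightarrow> 'h phil" and Fmor :: "'v obj \<Rightarrow> 'v obj \<Rightarrow> 'v mor \<Rightarrow> 'h \<Rightarrow> 'h"
    and Fob' :: "'v obj \<Rightarrow> 'j phil" and Fmor' :: "'v obj \<Rightarrow> 'v obj \<Rightarrow> 'v mor \<Rightarrow> 'j \<Rightarrow> 'j"
    and S :: "'v obj \<Rightarrow> 's set" and Smor :: "'v obj \<Rightarrow> 'v obj \<Rightarrow> 'v mor \<Rightarrow> 's \<Rightarrow> 's"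
  assumes "l_group G T"
    and "G_complex G T act X"
    and "almost_transitive G act X"
    and "phil_functor G act X Fob Fmor"
    and "semi_elementary_via G T act X Fob Fmor Fob' Fmor' S Smor"
  shows
    "(let Ob = objs G act X; X0 = objX G act X; A = CF_operators G act X Fob Fmor in
      \<comment> \<open>(i)\<close>
      bij_betw (\<lambda>a. a X0) A (End_G G act X Fob Fmor) \<and>
      (\<forall>a \<in> A. \<forall>b \<in> A. \<forall>c.
          op_add Ob Fob a b \<in> A \<and> op_scale Ob Fob c a \<in> A \<and> op_comp Ob a b \<in> A) \<and>
      (\<forall>a \<in> A. \<exists>b \<in> A. \<forall>Y \<in> Ob. is_adjoint (Fob Y) (b Y) (a Y)) \<and>
      \<comment> \<open>(ii)\<close>
      (\<forall>a \<in> A. \<exists>M \<ge> 0. \<forall>Y \<in> Ob. \<forall>u \<in> pcarrier (Fob Y).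
          pnorm (Fob Y) (a Y u) \<le> M * pnorm (Fob Y) u))"
proof -
  interpret G_complex_setting G T act X using assms(1,2) by unfold_locales
  obtain emb ret where "l2_retract G T act X Fob Fmor S Smor emb ret"
    using semi_elementary_l2_retract[OF assms(4,5)] by blast
  then interpret l2_retract G T act X Fob Fmor S Smor emb ret .
  show ?thesis unfolding Let_def
    by (intro conjI ballI allI bij_betw_CF_operators_End_G CF_operators_add[OF F]
        CF_operators_scale[OF F] CF_operators_comp[OF F] CF_operators_adjoint[OF F]
        CF_operators_bounded)
qed

end
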